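(* Let $d$ be a non-zero square-free integer and let $E^d:y^2=x^3-4320d^2x+96768d^3$. Then \begin{itemize} \item $\mathbb{Q}(E^d[2])=\mathbb{Q}(\sqrt2)$; \item $\mathbb{Q}(E^d[4])=\mathbb{Q}(\alpha,\sqrt d\,\sqrt[4]{2})$, where $f_4(\alpha)=0$ with $f_4(x)=x^8+6x^4+1$; \item $\mathbb{Q}(E^d[8])=\mathbb{Q}(\beta,\sqrt d)$, where $f_8(\beta)=0$ with $f_8(x)=x^{32}+16x^{31}+128x^{30}+672x^{29}+2544x^{28}+7200x^{27}+15352x^{26}+24272x^{25}+26904x^{24}+17312x^{23}-304x^{22}-11984x^{21}-9672x^{20}-2720x^{19}-3592x^{18}-7552x^{17}-2798x^{16}+6224x^{15}+6368x^{14}-672x^{13}-2224x^{12}+3360x^{11}+4952x^{10}-1072x^9-4600x^8-1120x^7+1776x^6+752x^5-264x^4-96x^3+24x^2+1.$ \end{itemize} In particular, $[\mathbb{Q}(E^d[2]):\mathbb{Q}]=2$ and $[\mathbb{Q}(E^d[4]):\mathbb{Q}]=16$, and $[\mathbb{Q}(E^d[8]):\mathbb{Q}]=32$ if and only if $d\in\{\pm1,\pm2\}$; otherwise $[\mathbb{Q}(E^d[8]):\mathbb{Q}]=64$.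
   Context: $\mathbb{Q}(E[n])$ is the field generated over $\mathbb{Q}$ by the coordinates of the $n$-torsion points of $E(\overline{\mathbb{Q}})$. *)

theory Defs
  imports Complex_Main "HOL-Algebra.Generated_Fields" "HOL-Algebra.Algebraic_Closure_Type"
begin

text \<open>
  The algebraic closure of the rationals is taken to be the field of algebraic numbers
  inside the complex numbers, and all number fields are subsets of the type \<^typ>\<open>complex\<close>.
\<close>

definition rat_bar :: "complex set" where
  "rat_bar = {z. algebraic z}"

abbreviation complex_field :: "complex ring" where
  "complex_field \<equiv> ring_of_type_algebra"

definition rat_adjoin :: "complex set \<Rightarrow> complex set" where
  "rat_adjoin S = generate_field complex_field S"

text \<open>
  The degree of \<open>K\<close> over the rationals is a relation, since \<^term>\<open>ring.dim\<close> is an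
  unspecified number when the dimension is infinite.
\<close>

definition has_rat_degree :: "complex set \<Rightarrow> nat \<Rightarrow> bool" where
  "has_rat_degree K n \<longleftrightarrow> ring.dimension complex_field n \<rat> K"

datatype 'a ell_point = Pt_infinity | Pt 'a 'a

text \<open>The points with coordinates in \<open>K\<close> of the curve \<open>y^2 = x^3 + a x + b\<close>.\<close>

definition ell_points :: "'a::field \<Rightarrow> 'a \<Rightarrow> 'a set \<Rightarrow> 'a ell_point set" where
  "ell_points a b K = insert Pt_infinity {Pt x y |x y. x \<in> K \<and> y \<in> K \<and> y ^ 2 = x ^ 3 + a * x + b}"

text \<open>
  The chord-tangent law. Two points of the curve with equal first coordinate are equal or
  opposite, so in the tangent case \<open>y1 = y2\<close> and this is nonzero.
\<close>

fun ell_add :: "'a::field \<Rightarrow> 'a ell_point \<Rightarrow> 'a ell_point \<Rightarrow> 'a ell_point" where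
  "ell_add a Pt_infinity Q = Q"
| "ell_add a P Pt_infinity = P"
| "ell_add a (Pt x1 y1) (Pt x2 y2) =
     (if x1 = x2 \<and> y1 = - y2 then Pt_infinity
      else
        let s = (if x1 = x2 then (3 * x1 ^ 2 + a) / (2 * y1) else (y2 - y1) / (x2 - x1));
            x3 = s ^ 2 - x1 - x2
        in Pt x3 (s * (x1 - x3) - y1))"

fun ell_mult :: "'a::field \<Rightarrow> nat \<Rightarrow> 'a ell_point \<Rightarrow> 'a ell_point" where
  "ell_mult a 0 P = Pt_infinity"
| "ell_mult a (Suc n) P = ell_add a P (ell_mult a n P)"

definition ell_torsion :: "'a::field \<Rightarrow> 'a \<Rightarrow> 'a set \<Rightarrow> nat \<Rightarrow> 'a ell_point set" where
  "ell_torsion a b K n = {P \<in> ell_points a b K. ell_mult a n P = Pt_infinity}"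

definition ell_coords :: "'a ell_point set \<Rightarrow> 'a set" where
  "ell_coords S = (\<Union>P\<in>S. case P of Pt_infinity \<Rightarrow> {} | Pt x y \<Rightarrow> {x, y})"

definition division_field :: "rat \<Rightarrow> rat \<Rightarrow> nat \<Rightarrow> complex set" where
  "division_field a b n = rat_adjoin (ell_coords (ell_torsion (of_rat a) (of_rat b) rat_bar n))"

definition Ed_division_field :: "int \<Rightarrow> nat \<Rightarrow> complex set" where
  "Ed_division_field d n = division_field (- 4320 * of_int d ^ 2) (96768 * of_int d ^ 3) n"

definition f4 :: "complex \<Rightarrow> complex" where
  "f4 x = x^8 + 6*x^4 + 1"

definition f8 :: "complex \<Rightarrow> complex" where
  "f8 x = x^32 + 16*x^31 + 128*x^30 + 672*x^29 + 2544*x^28 + 7200*x^27 + 15352*x^26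
     + 24272*x^25 + 26904*x^24 + 17312*x^23 - 304*x^22 - 11984*x^21 - 9672*x^20
     - 2720*x^19 - 3592*x^18 - 7552*x^17 - 2798*x^16 + 6224*x^15 + 6368*x^14
     - 672*x^13 - 2224*x^12 + 3360*x^11 + 4952*x^10 - 1072*x^9 - 4600*x^8
     - 1120*x^7 + 1776*x^6 + 752*x^5 - 264*x^4 - 96*x^3 + 24*x^2 + 1"

end

theory Submission
  imports Defs
begin

text \<open>
  Write \<open>w = \<surd>2\<close>, \<open>s = \<surd>(w - 1)\<close>, \<open>q = \<surd>w\<close>, \<open>t = \<surd>s\<close> and \<open>c = \<surd>d\<close>. The cubic of \<open>E^d\<close> has the roots
  \<open>e1 = 48 d\<close> and \<open>e2, e3 = (-24 \<plusminus> 36 w) d\<close>, so everything can be computed by repeated halving. If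
  \<open>r1, r2, r3\<close> are square roots of \<open>x - e1, x - e2, x - e3\<close>, then the point with abscissa
  \<open>e1 + (r1 + r2) (r1 + r3)\<close> and ordinate \<open>(r1 + r2) (r1 + r3) (r2 + r3)\<close> doubles to
  \<open>(x, r1 r2 r3)\<close>, and every affine point that is not of order 2 arises in this way. A field that
  contains \<open>e1, e2, e3\<close> and the coordinates of a point therefore contains those of its halves as
  soon as the three differences \<open>x - e\<^sub>i\<close> are squares in it.

  For a point of order 2 the nonzero differences are \<open>\<plusminus>1\<close> times the squares of \<open>6 c q s\<close>, \<open>6 c q / s\<close> and
  \<open>6 c q w\<close>; for a point of order 4 their square roots are explicit elements of
  \<open>\<rat>(\<i>, q, t, c)\<close>. This gives the upper bounds in
  \<open>\<rat>(E^d[2]) = \<rat>(w)\<close>, \<open>\<rat>(E^d[4]) = \<rat>(\<i>, w, s, c q)\<close> and \<open>\<rat>(E^d[8]) = \<rat>(\<i>, q, t, c)\<close>, and a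
  few explicit torsion points give the lower bounds.

  The degrees come from the tower \<open>\<rat> \<subset> \<rat>(w) \<subset> \<rat>(w, \<i>) \<subset> \<rat>(w, \<i>, s) \<subset> \<rat>(w, \<i>, s, q) \<subset>
  \<rat>(w, \<i>, s, q, t)\<close> of quadratic extensions. An element of \<open>K\<close> that is a square in \<open>K(\<surd>a)\<close> is a
  square or \<open>a\<close> times a square in \<open>K\<close>. Descending in this way, every question about squares
  becomes one about squares in \<open>\<rat>(w)\<close>, which is settled by norms and signs; in particular \<open>\<surd>d\<close> lies in
  the top field only if \<open>\<bar>d\<bar>\<close> or \<open>2 \<bar>d\<bar>\<close> is a square.

  A root of \<open>f4\<close> is an eighth root of unity times a conjugate of \<open>s\<close>. For \<open>f8\<close> the tower is used
  again: over each of its fields the current factor of \<open>f8\<close> has the form \<open>P^2 - a Q^2\<close> with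
  coprime \<open>P, Q\<close>, where \<open>\<surd>a\<close> generates the next field. At a root \<open>\<beta>\<close> this makes
  \<open>P(\<beta>) / Q(\<beta>)\<close> a square root of \<open>a\<close>, so \<open>\<rat>(\<beta>)\<close> contains a conjugate of each generator, and at
  the top it expresses \<open>\<beta>\<close> through them. Since the tower is normal over \<open>\<rat>\<close>, it does not matter
  which conjugates occur.
\<close>

section \<open>Subfields of the complex numbers and their degrees\<close>

text \<open>
  Closure under inverses is required of \<open>0\<close> as well; this is harmless, as \<open>inverse 0 = 0\<close>.
\<close>

locale complex_subfield =
  fixes K :: "complex set"
  assumes one_closed [simp, intro]: "1 \<in> K"
    and add_closed [simp, intro]: "\<lbrakk>x \<in> K; y \<in> K\<rbrakk> \<Longrightarrow> x + y \<in> K"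
    and uminus_closed [simp, intro]: "x \<in> K \<Longrightarrow> - x \<in> K"
    and mult_closed [simp, intro]: "\<lbrakk>x \<in> K; y \<in> K\<rbrakk> \<Longrightarrow> x * y \<in> K"
    and inverse_closed [simp, intro]: "x \<in> K \<Longrightarrow> inverse x \<in> K"
begin

lemma zero_closed [simp, intro]: "0 \<in> K"
  using add_closed[OF one_closed uminus_closed[OF one_closed]] by simp

lemma diff_closed [simp, intro]: "\<lbrakk>x \<in> K; y \<in> K\<rbrakk> \<Longrightarrow> x - y \<in> K"
  using add_closed[OF _ uminus_closed] by fastforce

lemma divide_closed [simp, intro]: "\<lbrakk>x \<in> K; y \<in> K\<rbrakk> \<Longrightarrow> x / y \<in> K"
  by (simp add: divide_inverse)

lemma power_closed [simp, intro]: "x \<in> K \<Longrightarrow> x ^ n \<in> K"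
  by (induction n) auto

lemma of_nat_closed [simp, intro]: "of_nat n \<in> K"
  by (induction n) auto

lemma numeral_closed [simp, intro]: "numeral n \<in> K"
  using of_nat_closed[of "numeral n"] by simp

lemma of_int_closed [simp, intro]: "of_int m \<in> K"
  by (cases m) auto

lemma of_rat_closed [simp, intro]: "of_rat r \<in> K"
  by (cases r) (simp add: of_rat_rat)

lemma Rats_subset: "\<rat> \<subseteq> K"
  by (auto elim: Rats_cases)

lemma mult_right_cancel_closed: "\<lbrakk>x * y \<in> K; y \<in> K; y \<noteq> 0\<rbrakk> \<Longrightarrow> x \<in> K"
  using divide_closed[of "x * y" y] by simp

lemma mult_left_cancel_closed: "\<lbrakk>y * x \<in> K; y \<in> K; y \<noteq> 0\<rbrakk> \<Longrightarrow> x \<in> K"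
  using mult_right_cancel_closed[of x y] by (simp add: mult.commute)

lemma add_right_cancel_closed: "\<lbrakk>x + y \<in> K; y \<in> K\<rbrakk> \<Longrightarrow> x \<in> K"
  using diff_closed[of "x + y" y] by simp

lemma add_left_cancel_closed: "\<lbrakk>y + x \<in> K; y \<in> K\<rbrakk> \<Longrightarrow> x \<in> K"
  using add_right_cancel_closed[of x y] by (simp add: add.commute)

lemma square_root_closed: "\<lbrakk>x\<^sup>2 = y\<^sup>2; y \<in> K\<rbrakk> \<Longrightarrow> x \<in> K"
  by (auto simp: power2_eq_iff)

end

lemma complex_field_simps [simp]:
  "carrier complex_field = UNIV"
  "monoid.mult complex_field = (*)"
  "monoid.one complex_field = 1"
  "ring.add complex_field = (+)"
  "ring.zero complex_field = 0"
  by (simp_all add: ring_of_type_algebra_def)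

lemma field_complex_field: "Ring.field complex_field"
  by (rule field_from_type_algebra)

interpretation cf: domain complex_field
  using field_complex_field by (rule field.axioms)

lemma a_inv_complex_field [simp]: "\<ominus>\<^bsub>complex_field\<^esub> x = - x"
  by (rule cf.minus_equality) simp_all

lemma m_inv_complex_field [simp]: "x \<noteq> 0 \<Longrightarrow> inv\<^bsub>complex_field\<^esub> x = inverse x"
  by (rule cf.comm_inv_char) simp_all

lemma pow_complex_field [simp]: "x [^]\<^bsub>complex_field\<^esub> (n::nat) = x ^ n"
  by (induction n) (simp_all add: mult.commute)

lemma subfield_complex_iff: "subfield K complex_field \<longleftrightarrow> complex_subfield K"
proof
  assume K: "subfield K complex_field"
  note R = subfieldE(1)[OF K]
  show "complex_subfield K"
  proof
    show "1 \<in> K" using subringE(3)[OF R] by simp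
    show "x + y \<in> K" "x * y \<in> K" if "x \<in> K" "y \<in> K" for x y
      using subringE(6,7)[OF R] that by simp_all
    show "- x \<in> K" if "x \<in> K" for x
      using subringE(5)[OF R] that by simp
    show "inverse x \<in> K" if "x \<in> K" for x
      using cf.subfield_m_inv(1)[OF K, of x] subringE(2)[OF R] that by (cases "x = 0") auto
  qed
next
  assume "complex_subfield K"
  then interpret complex_subfield K .
  show "subfield K complex_field"
  proof (rule field.subfieldI'[OF field_complex_field])
    show "subring K complex_field"
      by (rule cf.subringI) auto
  qed auto
qed

lemma complex_subfield_rat_adjoin [intro]: "complex_subfield (rat_adjoin S)"
  using field.generate_field_is_subfield[OF field_complex_field, of S]
  by (simp add: rat_adjoin_def subfield_complex_iff)

lemma rat_adjoin_incl: "x \<in> S \<Longrightarrow> x \<in> rat_adjoin S"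
  by (simp add: rat_adjoin_def generate_field.incl)

lemma rat_adjoin_subset: "\<lbrakk>complex_subfield K; S \<subseteq> K\<rbrakk> \<Longrightarrow> rat_adjoin S \<subseteq> K"
  using field.generate_field_min_subfield1[OF field_complex_field, of S K]
  by (simp add: rat_adjoin_def subfield_complex_iff)

lemma rat_adjoin_eqI:
  assumes "complex_subfield K" "S \<subseteq> K" "\<And>K'. \<lbrakk>complex_subfield K'; S \<subseteq> K'\<rbrakk> \<Longrightarrow> K \<subseteq> K'"
  shows "rat_adjoin S = K"
  using assms rat_adjoin_subset[OF assms(1,2)] rat_adjoin_incl[of _ S]
    complex_subfield_rat_adjoin[of S] by blast

lemma complex_subfield_Rats: "complex_subfield \<rat>"
  by unfold_locales auto

text \<open>
  For a field \<open>F\<close> and a square root \<open>u\<close> of an element of \<open>F\<close>, the field \<open>F(u)\<close>. The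
  definition also covers the case \<open>u \<in> F\<close>, where it gives \<open>F\<close> itself.
\<close>

definition quad_ext :: "complex set \<Rightarrow> complex \<Rightarrow> complex set" where
  "quad_ext F u = {a + b * u | a b. a \<in> F \<and> b \<in> F}"

lemma quad_extI: "\<lbrakk>a \<in> F; b \<in> F; x = a + b * u\<rbrakk> \<Longrightarrow> x \<in> quad_ext F u"
  by (auto simp: quad_ext_def)

lemma quad_extE:
  assumes "x \<in> quad_ext F u"
  obtains a b where "a \<in> F" "b \<in> F" "x = a + b * u"
  using assms by (auto simp: quad_ext_def)

context complex_subfield
begin

lemma subset_quad_ext: "K \<subseteq> quad_ext K u"
proof
  fix x assume "x \<in> K"
  then show "x \<in> quad_ext K u" by (intro quad_extI[of x _ 0]) auto
qed

lemma generator_in_quad_ext: "u \<in> quad_ext K u"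
  by (intro quad_extI[of 0 _ 1]) auto

lemma quad_ext_trivial: "u \<in> K \<Longrightarrow> quad_ext K u = K"
  using subset_quad_ext by (auto elim: quad_extE)

lemma quad_ext_subset:
  assumes "complex_subfield K'" "K \<subseteq> K'" "u \<in> K'"
  shows "quad_ext K u \<subseteq> K'"
proof -
  interpret K': complex_subfield K' by fact
  show ?thesis using assms by (auto elim!: quad_extE)
qed

text \<open>Coordinates with respect to \<open>1, u\<close> are unique when \<open>u\<close> is not in the base field.\<close>

lemma quad_ext_coords:
  assumes "u \<notin> K" "a \<in> K" "b \<in> K" "a' \<in> K" "b' \<in> K" "a + b * u = a' + b' * u"
  shows "a = a'" "b = b'"
proof -
  have *: "(b - b') * u = a' - a" using assms(6) by (simp add: algebra_simps)
  have "b = b'"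
  proof (rule ccontr)
    assume "b \<noteq> b'"
    then have "u = (a' - a) / (b - b')" using * by (simp add: field_simps)
    with assms show False by auto
  qed
  with * show "b = b'" "a = a'" by auto
qed

lemma complex_subfield_quad_ext:
  assumes "u\<^sup>2 \<in> K"
  shows "complex_subfield (quad_ext K u)"
proof (cases "u \<in> K")
  case True
  then show ?thesis using quad_ext_trivial complex_subfield_axioms by simp
next
  case False
  show ?thesis
  proof
    show "1 \<in> quad_ext K u" using subset_quad_ext by auto
  next
    fix x y assume "x \<in> quad_ext K u" "y \<in> quad_ext K u"
    then obtain a b a' b' where ab: "a \<in> K" "b \<in> K" "a' \<in> K" "b' \<in> K"
      and xy: "x = a + b * u" "y = a' + b' * u" by (metis quad_extE)
    show "x + y \<in> quad_ext K u"
      using ab xy by (intro quad_extI[of "a + a'" _ "b + b'"]) (auto simp: algebra_simps)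
    have u2: "u * u \<in> K" using assms by (simp add: power2_eq_square)
    show "x * y \<in> quad_ext K u"
      using ab xy u2
      by (intro quad_extI[of "a * a' + b * b' * (u * u)" _ "a * b' + a' * b"])
         (auto simp: algebra_simps)
  next
    fix x assume "x \<in> quad_ext K u"
    then obtain a b where ab: "a \<in> K" "b \<in> K" and x: "x = a + b * u" by (metis quad_extE)
    show "- x \<in> quad_ext K u"
      using ab x by (intro quad_extI[of "- a" _ "- b"]) auto
    define n where "n = a\<^sup>2 - b\<^sup>2 * u\<^sup>2"
    show "inverse x \<in> quad_ext K u"
    proof (cases "x = 0")
      case True
      then show ?thesis using subset_quad_ext by auto
    next
      case nz: False
      have n: "n = x * (a - b * u)"
        by (simp add: n_def x algebra_simps power2_eq_square)
      have "a - b * u \<noteq> 0"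
      proof
        assume 0: "a - b * u = 0"
        then have "a + (- b) * u = 0 + 0 * u" by simp
        then have "a = 0" "b = 0" using quad_ext_coords[OF False, of a "- b" 0 0] ab by auto
        then show False using nz x by simp
      qed
      with nz have "inverse x = (a - b * u) / n" by (simp add: n inverse_eq_divide)
      moreover have "n \<in> K" using ab assms by (auto simp: n_def)
      ultimately show ?thesis using ab
        by (intro quad_extI[of "a / n" _ "- b / n"]) (auto simp: diff_divide_distrib)
    qed
  qed
qed

text \<open>An element of the base field that becomes a square in \<open>K(u)\<close> was a square already or
  is \<open>u\<^sup>2\<close> times a square.\<close>

lemma square_in_quad_ext:
  assumes "u\<^sup>2 \<in> K" "u \<notin> K" "y \<in> quad_ext K u" "y\<^sup>2 \<in> K"
  obtains z where "z \<in> K" "y\<^sup>2 = z\<^sup>2 \<or> y\<^sup>2 = z\<^sup>2 * u\<^sup>2"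
proof -
  obtain a b where ab: "a \<in> K" "b \<in> K" and y: "y = a + b * u" using assms(3) by (rule quad_extE)
  have "(a\<^sup>2 + b\<^sup>2 * u\<^sup>2) + (2 * a * b) * u = y\<^sup>2 + 0 * u"
    by (simp add: y algebra_simps power2_eq_square)
  moreover have "a\<^sup>2 + b\<^sup>2 * u\<^sup>2 \<in> K" "2 * a * b \<in> K" using ab assms(1) by auto
  ultimately have "2 * a * b = 0" using quad_ext_coords(2)[OF assms(2)] assms(4) zero_closed by blast
  then consider "a = 0" | "b = 0" by auto
  then show ?thesis
  proof cases
    case 1
    then show ?thesis using that[of b] ab y by (simp add: power_mult_distrib)
  next
    case 2
    then show ?thesis using that[of a] ab y by simp
  qed
qed

lemma dimension_quad_ext:
  assumes "u\<^sup>2 \<in> K" "u \<notin> K"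
  shows "cf.dimension 2 K (quad_ext K u)"
proof -
  have "cf.dimension 1 K K"
    using cf.dimension_one subfield_complex_iff complex_subfield_axioms by blast
  then have "cf.dimension (Suc 1) K (cf.line_extension K u K)"
    using assms by (intro cf.Suc_dim) auto
  moreover have "cf.line_extension K u K = quad_ext K u"
    by (auto simp: cf.line_extension_mem_iff quad_ext_def) (metis add.commute)+
  ultimately show ?thesis by (simp add: numeral_2_eq_2)
qed

end

lemma has_rat_degree_quad_ext:
  assumes "complex_subfield F" "has_rat_degree F n" "u\<^sup>2 \<in> F" "u \<notin> F"
  shows "has_rat_degree (quad_ext F u) (2 * n)"
  using cf.telescopic_base[of \<rat> F n 2 "quad_ext F u"] assms
    complex_subfield.dimension_quad_ext[OF assms(1,3,4)] complex_subfield_Rats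
  by (simp add: has_rat_degree_def subfield_complex_iff mult.commute)

lemma has_rat_degree_Rats: "has_rat_degree \<rat> 1"
  using cf.dimension_one[of \<rat>] complex_subfield_Rats
  by (simp add: has_rat_degree_def subfield_complex_iff)

lemma has_rat_degree_unique: "\<lbrakk>has_rat_degree K m; has_rat_degree K n\<rbrakk> \<Longrightarrow> m = n"
  using cf.dimension_is_inj[of \<rat> m K n] complex_subfield_Rats
  by (simp add: has_rat_degree_def subfield_complex_iff)

text \<open>The list polynomials of \<^const>\<open>univ_poly\<close> start with the leading coefficient.\<close>

lemma eval_complex_field: "cf.eval p x = poly (Poly (rev p)) x"
  by (induction p) (auto simp: Poly_append poly_monom algebra_simps)

text \<open>
  The powers of an element of a finite extension are linearly dependent. This supplies the
  algebraicity of sums and products of algebraic numbers where it is needed.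
\<close>

lemma algebraic_if_has_rat_degree:
  assumes "complex_subfield K" "has_rat_degree K n" "x \<in> K"
  shows "algebraic x"
proof -
  have Q: "subfield \<rat> complex_field"
    using complex_subfield_Rats by (simp add: subfield_complex_iff)
  have K: "subring K complex_field"
    using assms(1) subfieldE(1) by (simp add: subfield_complex_iff[symmetric])
  have "cf.finite_dimension \<rat> K"
    using assms(2) cf.finite_dimensionI by (simp add: has_rat_degree_def)
  then have "(cf.algebraic over \<rat>) x"
    using cf.finite_dimension_imp_algebraic[OF Q K] assms(3) by blast
  then obtain p where p: "p \<in> carrier (univ_poly complex_field \<rat>)" "p \<noteq> []" "cf.eval p x = 0"
    using cf.algebraicE[OF subfieldE(1)[OF Q], of x] by auto
  have poly: "polynomial\<^bsub>complex_field\<^esub> \<rat> p"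
    using p(1) by (simp add: univ_poly_carrier)
  then have set: "set p \<subseteq> \<rat>" and lead: "hd p \<noteq> 0"
    using p(2) by (auto simp: polynomial_def)
  show ?thesis
  proof (rule algebraicI')
    show "coeff (Poly (rev p)) i \<in> \<rat>" for i
      using set by (auto simp: nth_default_def rev_nth)
    show "Poly (rev p) \<noteq> 0"
    proof
      assume "Poly (rev p) = 0"
      then have "coeff (Poly (rev p)) (length p - 1) = 0" by simp
      then show False using lead p(2) by (simp add: nth_default_def rev_nth hd_conv_nth)
    qed
    show "poly (Poly (rev p)) x = 0" using p(3) by (simp add: eval_complex_field)
  qed
qed

section \<open>The group law on a Weierstrass curve\<close>

text \<open>The opposite point.\<close>

fun ell_neg :: "'a::field ell_point \<Rightarrow> 'a ell_point" where
  "ell_neg Pt_infinity = Pt_infinity"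
| "ell_neg (Pt x y) = Pt x (- y)"

lemma ell_neg_neg [simp]: "ell_neg (ell_neg P) = P"
  by (cases P) auto

lemma ell_add_infinity_right [simp]: "ell_add a P Pt_infinity = P"
  by (cases P) auto

lemma ell_add_neg_self [simp]: "ell_add a P (ell_neg P) = Pt_infinity"
  by (cases P) auto

lemma ell_add_eq_infinity_iff: "ell_add a P Q = Pt_infinity \<longleftrightarrow> Q = ell_neg P"
  by (cases P; cases Q) (auto simp: Let_def)

lemma ell_neg_add:
  fixes P Q :: "'a::field_char_0 ell_point"
  shows "ell_neg (ell_add a P Q) = ell_add a (ell_neg P) (ell_neg Q)"
proof (cases P)
  case (Pt x1 y1)
  show ?thesis
  proof (cases Q)
    case (Pt x2 y2)
    define s where "s = (if x1 = x2 then (3 * x1 ^ 2 + a) / (2 * y1) else (y2 - y1) / (x2 - x1))"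
    define s' where "s' = (if x1 = x2 then (3 * x1 ^ 2 + a) / (2 * (- y1)) else (- y2 - (- y1)) / (x2 - x1))"
    have "s' = - s" by (auto simp: s_def s'_def minus_divide_left)
    show ?thesis
    proof (cases "x1 = x2 \<and> y1 = - y2")
      case True
      then show ?thesis using \<open>P = Pt x1 y1\<close> Pt by simp
    next
      case False
      then have "ell_add a P Q = Pt (s\<^sup>2 - x1 - x2) (s * (x1 - (s\<^sup>2 - x1 - x2)) - y1)"
        using \<open>P = Pt x1 y1\<close> Pt by (simp add: s_def Let_def)
      moreover have "ell_add a (ell_neg P) (ell_neg Q)
          = Pt (s'\<^sup>2 - x1 - x2) (s' * (x1 - (s'\<^sup>2 - x1 - x2)) - (- y1))"
        using False \<open>P = Pt x1 y1\<close> Pt by (auto simp: s'_def Let_def)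
      ultimately show ?thesis by (simp add: \<open>s' = - s\<close>)
    qed
  qed auto
qed auto

text \<open>A nonsingular curve \<open>y^2 = x^3 + a x + b\<close>: the cubic and its derivative have no common zero.\<close>

locale ell_curve =
  fixes a b :: "'a::field_char_0"
  assumes nonsingular: "x ^ 3 + a * x + b = 0 \<Longrightarrow> 3 * x\<^sup>2 + a \<noteq> 0"
begin

abbreviation on_curve :: "'a ell_point \<Rightarrow> bool" where
  "on_curve P \<equiv> P \<in> ell_points a b UNIV"

abbreviation add (infixl \<open>\<boxplus>\<close> 65) where "P \<boxplus> Q \<equiv> ell_add a P Q"

lemma on_curve_infinity [simp]: "on_curve Pt_infinity"
  by (simp add: ell_points_def)

lemma on_curve_Pt [simp]: "on_curve (Pt x y) \<longleftrightarrow> y\<^sup>2 = x ^ 3 + a * x + b"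
  by (simp add: ell_points_def)

lemma on_curve_neg [simp]: "on_curve (ell_neg P) \<longleftrightarrow> on_curve P"
  by (cases P) auto

text \<open>
  The line \<open>y = s x + c\<close> meets the curve in the abscissas \<open>x1, x2, x3\<close>, counted with
  multiplicity: these are the relations between roots and coefficients of
  \<open>X^3 + a X + b - (s X + c)^2\<close>.
\<close>

definition on_line :: "'a \<Rightarrow> 'a \<Rightarrow> 'a \<Rightarrow> 'a \<Rightarrow> 'a \<Rightarrow> bool" where
  "on_line s c x1 x2 x3 \<longleftrightarrow> x1 + x2 + x3 = s\<^sup>2 \<and> x1 * x2 + x1 * x3 + x2 * x3 = a - 2 * s * c
     \<and> x1 * x2 * x3 = c\<^sup>2 - b"

lemma add_on_line:
  assumes P: "on_curve (Pt x1 y1)" and Q: "on_curve (Pt x2 y2)"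
    and ne: "\<not> (x1 = x2 \<and> y1 = - y2)"
  obtains s c x3 where "y1 = s * x1 + c" "y2 = s * x2 + c" "on_line s c x1 x2 x3"
    "Pt x1 y1 \<boxplus> Pt x2 y2 = Pt x3 (- (s * x3 + c))"
proof -
  define s where "s = (if x1 = x2 then (3 * x1\<^sup>2 + a) / (2 * y1) else (y2 - y1) / (x2 - x1))"
  define c where "c = y1 - s * x1"
  define x3 where "x3 = s\<^sup>2 - x1 - x2"
  have y1: "y1 = s * x1 + c" by (simp add: c_def)
  have c2: "(s * x1 + c)\<^sup>2 = x1 ^ 3 + a * x1 + b" using P y1 by simp
  have *: "y2 = s * x2 + c \<and> x1 * x2 + x1 * x3 + x2 * x3 = a - 2 * s * c"
  proof (cases "x1 = x2")
    case True
    have "(y1 - y2) * (y1 + y2) = 0" using P Q True by (simp add: algebra_simps power2_eq_square)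
    moreover have "y1 + y2 \<noteq> 0" using ne True by (simp add: eq_neg_iff_add_eq_0)
    ultimately have y: "y1 = y2" by simp
    have y10: "y1 \<noteq> 0" using ne True y by (metis minus_zero)
    have "s = (3 * x1\<^sup>2 + a) / (2 * y1)" using True by (simp add: s_def)
    then have s: "2 * s * y1 = 3 * x1\<^sup>2 + a" using y10 by simp
    show ?thesis
    proof
      show "y2 = s * x2 + c" using True y y1 by simp
      show "x1 * x2 + x1 * x3 + x2 * x3 = a - 2 * s * c"
        using s unfolding x3_def True[symmetric] c_def by Groebner_Basis.algebra
    qed
  next
    case False
    then have s: "s * (x2 - x1) = y2 - y1" by (simp add: s_def)
    then have y2: "y2 = s * x2 + c" unfolding c_def by Groebner_Basis.algebra
    have "(s * x2 + c)\<^sup>2 = x2 ^ 3 + a * x2 + b" using Q y2 by simp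
    moreover have "(x1 - x2) * (x1 * x2 + x1 * x3 + x2 * x3 - (a - 2 * s * c))
        = ((s * x1 + c)\<^sup>2 - (x1 ^ 3 + a * x1 + b)) - ((s * x2 + c)\<^sup>2 - (x2 ^ 3 + a * x2 + b))"
      unfolding x3_def by (simp add: algebra_simps power2_eq_square power3_eq_cube)
    ultimately have "(x1 - x2) * (x1 * x2 + x1 * x3 + x2 * x3 - (a - 2 * s * c)) = 0"
      using c2 by simp
    with False y2 show ?thesis by simp
  qed
  have "x1 * x2 * x3 = x1 * (x1 * x2 + x1 * x3 + x2 * x3) - x1\<^sup>2 * (s\<^sup>2 - x1)"
    unfolding x3_def by (simp add: algebra_simps power2_eq_square)
  also have "\<dots> = x1 * (a - 2 * s * c) - x1\<^sup>2 * (s\<^sup>2 - x1)" using * by simp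
  also have "\<dots> = c\<^sup>2 - b"
    using c2 by (simp add: algebra_simps power2_eq_square power3_eq_cube)
  finally have line: "on_line s c x1 x2 x3" using * by (simp add: on_line_def x3_def)
  have "Pt x1 y1 \<boxplus> Pt x2 y2 = Pt x3 (s * (x1 - x3) - y1)"
    using ne by (simp add: Let_def s_def x3_def)
  then have "Pt x1 y1 \<boxplus> Pt x2 y2 = Pt x3 (- (s * x3 + c))"
    by (simp add: y1 algebra_simps)
  then show ?thesis using that y1 * line by blast
qed

lemma add_eq_if_on_line:
  assumes "y1 = s * x1 + c" "y2 = s * x2 + c" "on_line s c x1 x2 x3"
    and ne: "\<not> (x1 = x2 \<and> y1 = - y2)"
  shows "Pt x1 y1 \<boxplus> Pt x2 y2 = Pt x3 (- (s * x3 + c))"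
proof -
  define s' where "s' = (if x1 = x2 then (3 * x1\<^sup>2 + a) / (2 * y1) else (y2 - y1) / (x2 - x1))"
  have "s' = s"
  proof (cases "x1 = x2")
    case True
    have "y1 = y2" using True assms by simp
    with ne True have y1: "y1 \<noteq> 0" by auto
    have "3 * x1\<^sup>2 + a = s * (2 * y1)"
      using assms(1,3) True unfolding on_line_def by Groebner_Basis.algebra
    with y1 show ?thesis using True by (simp add: s'_def)
  next
    case False
    then show ?thesis using assms(1,2) by (simp add: s'_def field_simps)
  qed
  moreover have "s\<^sup>2 - x1 - x2 = x3" 
    using assms(3) unfolding on_line_def by Groebner_Basis.algebra
  ultimately have "Pt x1 y1 \<boxplus> Pt x2 y2 = Pt x3 (s * (x1 - x3) - y1)"
    using ne unfolding ell_add.simps s'_def[symmetric] Let_def by simp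
  then show ?thesis by (simp add: assms(1) right_diff_distrib)
qed

lemma on_line_on_curve: "on_line s c x1 x2 x3 \<Longrightarrow> on_curve (Pt x3 (- (s * x3 + c)))"
  unfolding on_line_def on_curve_Pt by Groebner_Basis.algebra

lemma on_line_swap: "on_line s c x1 x2 x3 \<Longrightarrow> on_line s c x2 x1 x3"
  by (simp add: on_line_def algebra_simps)

lemma on_line_neg: "on_line s c x1 x2 x3 \<Longrightarrow> on_line (- s) (- c) x3 x1 x2"
  by (simp add: on_line_def algebra_simps)

lemma on_curve_add [simp]:
  assumes "on_curve P" "on_curve Q"
  shows "on_curve (P \<boxplus> Q)"
proof (cases P)
  case P: (Pt x1 y1)
  show ?thesis
  proof (cases Q)
    case Q: (Pt x2 y2)
    show ?thesis
    proof (cases "x1 = x2 \<and> y1 = - y2")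
      case True
      then show ?thesis using P Q by simp
    next
      case False
      then show ?thesis using add_on_line[of x1 y1 x2 y2] assms P Q on_line_on_curve by metis
    qed
  qed (use assms in auto)
qed (use assms in auto)

lemma add_commute:
  assumes "on_curve P" "on_curve Q"
  shows "P \<boxplus> Q = Q \<boxplus> P"
proof (cases P)
  case P: (Pt x1 y1)
  show ?thesis
  proof (cases Q)
    case Q: (Pt x2 y2)
    show ?thesis
    proof (cases "x1 = x2 \<and> y1 = - y2")
      case True
      then show ?thesis using P Q by simp
    next
      case False
      obtain s c x3 where "y1 = s * x1 + c" "y2 = s * x2 + c" "on_line s c x1 x2 x3"
        "Pt x1 y1 \<boxplus> Pt x2 y2 = Pt x3 (- (s * x3 + c))"
        using add_on_line[of x1 y1 x2 y2] False assms P Q by metis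
      moreover from this have "Pt x2 y2 \<boxplus> Pt x1 y1 = Pt x3 (- (s * x3 + c))"
        using False by (intro add_eq_if_on_line) (auto intro: on_line_swap)
      ultimately show ?thesis using P Q by simp
    qed
  qed (use assms in auto)
qed (use assms in auto)

text \<open>
  Adding \<open>-P\<close> undoes the addition of \<open>P\<close>: the three points in question lie on the mirror
  image of the line through \<open>P\<close> and \<open>Q\<close>. Besides \<open>4 P = 2 P + 2 P\<close>, the computation of
  multiples below needs no other instance of associativity.
\<close>

lemma add_cancel:
  assumes "on_curve P" "on_curve Q"
  shows "(P \<boxplus> Q) \<boxplus> ell_neg P = Q"
proof (cases P)
  case P: (Pt x1 y1)
  show ?thesis
  proof (cases Q)
    case Q: (Pt x2 y2)
    show ?thesis
    proof (cases "x1 = x2 \<and> y1 = - y2")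
      case True
      then show ?thesis using P Q by simp
    next
      case False
      obtain s c x3 where y1: "y1 = s * x1 + c" and y2: "y2 = s * x2 + c"
        and line: "on_line s c x1 x2 x3"
        and sum: "Pt x1 y1 \<boxplus> Pt x2 y2 = Pt x3 (- (s * x3 + c))"
        using add_on_line[of x1 y1 x2 y2] False assms P Q by metis
      have ne: "\<not> (x3 = x1 \<and> - (s * x3 + c) = - (- y1))"
      proof
        assume *: "x3 = x1 \<and> - (s * x3 + c) = - (- y1)"
        then have "- y1 = y1" by (metis y1 minus_minus)
        then have "2 * y1 = 0" by (metis mult_2 add.right_inverse)
        then have y0: "y1 = 0" by simp
        have "3 * x1\<^sup>2 + a = 0" using line y0 y1 * unfolding on_line_def by Groebner_Basis.algebra
        moreover have "x1 ^ 3 + a * x1 + b = 0" using assms(1) P y0 by simp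
        ultimately show False using nonsingular by blast
      qed
      have "Pt x3 (- (s * x3 + c)) \<boxplus> Pt x1 (- y1) = Pt x2 (- (- s * x2 + - c))"
        using ne on_line_neg[OF line] by (intro add_eq_if_on_line) (auto simp: y1)
      then show ?thesis using P Q sum by (simp add: y2)
    qed
  qed (use P in auto)
qed (use assms in auto)

lemma double_ne_self:
  assumes "on_curve P" "P \<noteq> Pt_infinity"
  shows "P \<boxplus> P \<noteq> P"
  using add_cancel[of P P] assms by (metis ell_add_neg_self)

lemma same_abscissa:
  assumes "on_curve (Pt x y)" "on_curve (Pt x y')"
  shows "Pt x y' = Pt x y \<or> Pt x y' = ell_neg (Pt x y)"
  using assms power2_eq_iff[of y' y] by auto

text \<open>
  The generic case of \<open>P + (P + 2 P) = 2 P + 2 P\<close> for \<open>P = (x, y)\<close>. Here \<open>m\<close> is the slope of the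
  tangent at \<open>P\<close>, \<open>2 P = (x + u, - k)\<close>, \<open>l\<close> is the slope of the line through \<open>P\<close> and \<open>2 P\<close>, \<open>x + v\<close>
  is the abscissa of \<open>3 P\<close>, \<open>n\<close> is the slope of the line through \<open>P\<close> and \<open>3 P\<close>, and \<open>\<kappa>\<close> is the
  slope of the tangent at \<open>2 P\<close>. The key point is \<open>\<kappa> = - m - 2 y / v\<close>.
\<close>

lemma quadruple_generic:
  fixes x y u m k v l n \<kappa> x4 :: 'a
  assumes y: "y \<noteq> 0" and u: "u \<noteq> 0" and k: "k \<noteq> 0"
    and slope: "2 * m * y = 3 * x\<^sup>2 + a" and u_def: "u = m\<^sup>2 - 3 * x" and k_def: "k = m * u + y"
    and v: "v = 4 * y * k / u\<^sup>2" and l: "l = - m - 2 * y / u" and n: "n = - l - 2 * y / v"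
    and kappa: "\<kappa> = (3 * (x + u)\<^sup>2 + a) / (2 * - k)" and x4: "x4 = n\<^sup>2 - 2 * x - v"
  shows "\<kappa>\<^sup>2 - 2 * (x + u) = x4" and "\<kappa> * (x + u - x4) + k = n * (x - x4) - y"
proof -
  define w where "w = u\<^sup>2 / (2 * k)"
  have w: "2 * y / v = w" using y u k by (simp add: v w_def field_simps)
  have kw: "2 * k * w = u\<^sup>2" using k by (simp add: w_def)
  have "3 * (x + u)\<^sup>2 + a = (- m - w) * (2 * - k)"
    using slope kw u_def unfolding k_def by Groebner_Basis.algebra
  then have kappa: "\<kappa> = - m - w"
    using k by (simp add: kappa)
  define t where "t = 2 * y / u"
  have tu: "t * u = 2 * y" using u by (simp add: t_def)
  have nw: "n = m + t - w" using w by (simp add: n l t_def)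
  have mk: "(2 * m + t) * u = 2 * k" using tu by (simp add: k_def algebra_simps)
  have vw: "v * w = 2 * y" using w y v k u by (auto simp: field_simps)
  have w0: "w \<noteq> 0" using u k by (simp add: w_def)
  have tv: "v * u\<^sup>2 = 4 * y * k" using u by (simp add: v)
  have mw: "(2 * m + t) * w = u"
  proof -
    have "u * ((2 * m + t) * w) = u * u" using mk kw by Groebner_Basis.algebra
    then show ?thesis using u by simp
  qed
  have mt: "(2 * m + t) * t = v"
  proof -
    have "u\<^sup>2 * ((2 * m + t) * t) = u\<^sup>2 * v" using mk tu tv by Groebner_Basis.algebra
    then show ?thesis using u by simp
  qed
  have "\<kappa>\<^sup>2 - n\<^sup>2 = 2 * ((2 * m + t) * w) - (2 * m + t) * t"
    unfolding kappa nw by (simp add: algebra_simps power2_eq_square)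
  then have "\<kappa>\<^sup>2 - n\<^sup>2 = 2 * u - v" by (simp only: mw mt)
  then show "\<kappa>\<^sup>2 - 2 * (x + u) = x4" by (simp add: x4 algebra_simps)
  have "x - x4 = v - u - ((2 * m + t) * t - (2 * m + t) * w) + (t - w) * w"
    unfolding x4 nw u_def by (simp add: algebra_simps power2_eq_square)
  then have "x - x4 = (t - w) * w" by (simp add: mw mt)
  then have "(2 * m + t) * (x - x4) = (t - w) * ((2 * m + t) * w)" by simp
  also have "\<dots> = (t - w) * u" by (simp only: mw)
  also have "\<dots> = 2 * y - w * u" by (simp only: left_diff_distrib tu)
  finally show "\<kappa> * (x + u - x4) + k = n * (x - x4) - y"
    unfolding kappa nw k_def by Groebner_Basis.algebra
qed

lemma quadruple_eq:
  assumes P: "on_curve P"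
  shows "P \<boxplus> (P \<boxplus> (P \<boxplus> P)) = (P \<boxplus> P) \<boxplus> (P \<boxplus> P)"
proof (cases P)
  case Pt: (Pt x y)
  let ?P2 = "P \<boxplus> P" and ?P3 = "P \<boxplus> (P \<boxplus> P)"
  have on: "on_curve ?P2" "on_curve ?P3" using P by simp_all
  show ?thesis
  proof (cases "y = 0")
    case True
    then show ?thesis using Pt by simp
  next
    case y: False
    define m where "m = (3 * x\<^sup>2 + a) / (2 * y)"
    define u where "u = m\<^sup>2 - 3 * x"
    define k where "k = m * u + y"
    have P2: "?P2 = Pt (x + u) (- k)"
      using y by (simp add: Pt Let_def m_def[symmetric]) (simp add: u_def k_def algebra_simps)
    show ?thesis
    proof (cases "u = 0")
      case True
      then have "?P2 = ell_neg P"
        using same_abscissa[of x y "- k"] on(1) P P2 Pt double_ne_self[OF P] by auto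
      then show ?thesis using ell_neg_add[of a P P] by simp
    next
      case u: False
      define l where "l = - m - 2 * y / u"
      have l: "(- k - y) / (x + u - x) = l" using u by (simp add: l_def k_def field_simps)
      define v where "v = l\<^sup>2 - m\<^sup>2"
      have P3: "?P3 = Pt (x + v) (- (y + l * v))"
        unfolding P2 unfolding Pt ell_add.simps l Let_def using u
        by (simp add: v_def u_def algebra_simps)
      have v: "v = 4 * y * k / u\<^sup>2"
        using u by (simp add: v_def l_def k_def field_simps power2_eq_square)
      show ?thesis
      proof (cases "v = 0")
        case True
        have "?P3 \<noteq> P"
          using add_cancel[OF P on(1)] P2 by (metis ell_add_neg_self ell_point.distinct(1))
        then have P3': "?P3 = ell_neg P"
          using same_abscissa[of x y "- (y + l * v)"] on(2) P P3 Pt True by auto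
        then have "?P2 = ell_neg ?P2"
          using add_cancel[OF P on(1)] by (simp add: ell_neg_add)
        then show ?thesis using P3' by (metis ell_add_neg_self)
      next
        case False
        then have k: "k \<noteq> 0" using v by auto
        define n where "n = - l - 2 * y / v"
        have n: "(- (y + l * v) - y) / (x + v - x) = n" using False by (simp add: n_def field_simps)
        have slope: "2 * m * y = 3 * x\<^sup>2 + a" using y by (simp add: m_def)
        define \<kappa> where "\<kappa> = (3 * (x + u)\<^sup>2 + a) / (2 * - k)"
        define x4 where "x4 = n\<^sup>2 - 2 * x - v"
        note generic = quadruple_generic[OF y u k slope u_def k_def v l_def n_def \<kappa>_def x4_def]
        have "n\<^sup>2 - x - (x + v) = x4" by (simp add: x4_def)
        then have "P \<boxplus> ?P3 = Pt x4 (n * (x - x4) - y)"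
          unfolding P3 unfolding Pt ell_add.simps n Let_def using False by simp
        moreover have "\<kappa>\<^sup>2 - (x + u) - (x + u) = x4" using generic(1) by (simp add: algebra_simps)
        then have "?P2 \<boxplus> ?P2 = Pt x4 (\<kappa> * (x + u - x4) + k)"
          unfolding P2 ell_add.simps Let_def \<kappa>_def[symmetric] using k by simp
        moreover note generic(2)
        ultimately show ?thesis by simp
      qed
    qed
  qed
qed simp

lemma on_curve_mult [simp]: "on_curve P \<Longrightarrow> on_curve (ell_mult a n P)"
  by (induction n) auto

lemma mult_double: "ell_mult a 2 P = P \<boxplus> P"
  by (simp add: numeral_eq_Suc)

lemma mult_quadruple:
  "on_curve P \<Longrightarrow> ell_mult a 4 P = (P \<boxplus> P) \<boxplus> (P \<boxplus> P)"
  using quadruple_eq by (simp add: numeral_eq_Suc)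

lemma mult_diff_self:
  "on_curve P \<Longrightarrow> ell_mult a (Suc n) P \<boxplus> ell_neg P = ell_mult a n P"
  by (simp add: add_cancel)

text \<open>
  If \<open>n P\<close> equals its opposite, then multiples on both sides of \<open>n P\<close> are opposite to each
  other. The next two lemmas walk outwards from \<open>n P\<close> and inwards from \<open>2 n P\<close>; together
  they show that \<open>2 n P\<close> vanishes iff \<open>n P\<close> is its own opposite, without general associativity.
\<close>

lemma mult_add_eq_neg_mult_diff:
  assumes "on_curve P" "ell_mult a n P = ell_neg (ell_mult a n P)" "k \<le> n"
  shows "ell_mult a (n + k) P = ell_neg (ell_mult a (n - k) P)"
  using assms(3)
proof (induction k)
  case (Suc k)
  have "ell_mult a (n + Suc k) P = P \<boxplus> ell_neg (ell_mult a (n - k) P)"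
    using Suc by simp
  also have "\<dots> = ell_neg (ell_neg P \<boxplus> ell_mult a (n - k) P)"
    by (simp add: ell_neg_add)
  also have "ell_neg P \<boxplus> ell_mult a (n - k) P = ell_mult a (Suc (n - Suc k)) P \<boxplus> ell_neg P"
    using Suc.prems assms(1) by (subst add_commute) (simp_all add: Suc_diff_Suc del: ell_mult.simps)
  finally show ?case using mult_diff_self[OF assms(1)] by metis
qed (use assms in simp)

lemma mult_diff_eq_neg_mult_add:
  assumes "on_curve P" "ell_mult a (2 * n) P = Pt_infinity" "k \<le> 2 * n"
  shows "ell_mult a (2 * n - k) P = ell_neg (ell_mult a k P)"
  using assms(3)
proof (induction k)
  case (Suc k)
  have "ell_mult a (2 * n - Suc k) P = ell_mult a (Suc (2 * n - Suc k)) P \<boxplus> ell_neg P"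
    using mult_diff_self[OF assms(1)] by metis
  also have "Suc (2 * n - Suc k) = 2 * n - k" using Suc.prems by simp
  also have "ell_mult a (2 * n - k) P \<boxplus> ell_neg P = ell_neg (ell_mult a k P \<boxplus> P)"
    using Suc by (simp add: ell_neg_add)
  also have "ell_mult a k P \<boxplus> P = ell_mult a (Suc k) P"
    using assms(1) by (simp add: add_commute)
  finally show ?case .
qed (use assms in simp)

lemma mult_double_eq_infinity_iff:
  assumes "on_curve P"
  shows "ell_mult a (2 * n) P = Pt_infinity
    \<longleftrightarrow> ell_mult a n P = ell_neg (ell_mult a n P)"
  using mult_add_eq_neg_mult_diff[OF assms, of n n] mult_diff_eq_neg_mult_add[OF assms, of n n]
  by (auto simp: mult_2)

end

section \<open>Halving points on a curve with full 2-torsion\<close>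

text \<open>The curve \<open>y^2 = (x - e1) (x - e2) (x - e3)\<close>, written as \<open>y^2 = x^3 + A x + B\<close>.\<close>

locale split_curve =
  fixes e1 e2 e3 :: "'a::field_char_0"
  assumes sum_zero: "e1 + e2 + e3 = 0"
    and distinct: "e1 \<noteq> e2" "e1 \<noteq> e3" "e2 \<noteq> e3"
begin

lemma e3_eq: "e3 = - e1 - e2"
  using sum_zero by Groebner_Basis.algebra

definition A :: 'a where "A = e1 * e2 + e1 * e3 + e2 * e3"

definition B :: 'a where "B = - (e1 * e2 * e3)"

lemma cubic_factor: "x ^ 3 + A * x + B = (x - e1) * (x - e2) * (x - e3)"
proof -
  show ?thesis unfolding A_def B_def by (simp add: e3_eq power3_eq_cube algebra_simps)
qed

sublocale ell_curve A B
proof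
  fix x assume "x ^ 3 + A * x + B = 0"
  then have x: "x = e1 \<or> x = e2 \<or> x = e3" by (simp add: cubic_factor)
  have "3 * x\<^sup>2 + A = (x - e1) * (x - e2) + (x - e1) * (x - e3) + (x - e2) * (x - e3)"
    unfolding A_def by (simp add: e3_eq power2_eq_square algebra_simps)
  with x show "3 * x\<^sup>2 + A \<noteq> 0" using distinct by auto
qed

notation add (infixl \<open>\<boxplus>\<close> 65)

lemma on_curve_iff: "on_curve (Pt x y) \<longleftrightarrow> y\<^sup>2 = (x - e1) * (x - e2) * (x - e3)"
  by (simp add: cubic_factor)

text \<open>
  A point \<open>P\<close> with \<open>2 P = (x, y)\<close> corresponds to a choice of square roots \<open>r\<^sub>i\<close> of
  \<open>x - e\<^sub>i\<close> whose product is \<open>y\<close>; the following definitions express the coordinates of \<open>P\<close>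
  through these roots.
\<close>

definition roots :: "'a \<Rightarrow> 'a \<Rightarrow> 'a \<Rightarrow> 'a \<Rightarrow> bool" where
  "roots x r1 r2 r3 \<longleftrightarrow> r1\<^sup>2 = x - e1 \<and> r2\<^sup>2 = x - e2 \<and> r3\<^sup>2 = x - e3"

definition half_x :: "'a \<Rightarrow> 'a \<Rightarrow> 'a \<Rightarrow> 'a" where
  "half_x r1 r2 r3 = e1 + (r1 + r2) * (r1 + r3)"

definition half_y :: "'a \<Rightarrow> 'a \<Rightarrow> 'a \<Rightarrow> 'a" where
  "half_y r1 r2 r3 = (r1 + r2) * (r1 + r3) * (r2 + r3)"

abbreviation half :: "'a \<Rightarrow> 'a \<Rightarrow> 'a \<Rightarrow> 'a ell_point" where
  "half r1 r2 r3 \<equiv> Pt (half_x r1 r2 r3) (half_y r1 r2 r3)"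

lemma half_x_diffs:
  assumes "roots x r1 r2 r3"
  shows "half_x r1 r2 r3 - e1 = (r1 + r2) * (r1 + r3)"
    and "half_x r1 r2 r3 - e2 = (r1 + r2) * (r2 + r3)"
    and "half_x r1 r2 r3 - e3 = (r1 + r3) * (r2 + r3)"
proof -
  have e: "e1 = x - r1\<^sup>2" "e2 = x - r2\<^sup>2" "e3 = x - r3\<^sup>2" using assms by (auto simp: roots_def)
  show "half_x r1 r2 r3 - e1 = (r1 + r2) * (r1 + r3)"
    and "half_x r1 r2 r3 - e2 = (r1 + r2) * (r2 + r3)"
    and "half_x r1 r2 r3 - e3 = (r1 + r3) * (r2 + r3)"
    unfolding half_x_def by (simp_all add: e power2_eq_square algebra_simps)
qed

lemma half_y_nonzero:
  assumes "roots x r1 r2 r3"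
  shows "half_y r1 r2 r3 \<noteq> 0"
proof -
  have "r1\<^sup>2 \<noteq> r2\<^sup>2" "r1\<^sup>2 \<noteq> r3\<^sup>2" "r2\<^sup>2 \<noteq> r3\<^sup>2" using assms distinct by (auto simp: roots_def)
  then have "r1 + r2 \<noteq> 0" "r1 + r3 \<noteq> 0" "r2 + r3 \<noteq> 0"
    by (auto simp: add_eq_0_iff)
  then show ?thesis by (simp add: half_y_def)
qed

lemma on_curve_half:
  assumes "roots x r1 r2 r3"
  shows "on_curve (half r1 r2 r3)"
  unfolding on_curve_iff half_x_diffs[OF assms]
  by (simp add: half_y_def power2_eq_square)

lemma double_half:
  assumes "roots x r1 r2 r3"
  shows "half r1 r2 r3 \<boxplus> half r1 r2 r3 = Pt x (r1 * r2 * r3)"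
proof -
  let ?X = "half_x r1 r2 r3" and ?Y = "half_y r1 r2 r3" and ?m = "r1 + r2 + r3"
  have y: "?Y \<noteq> 0" using assms by (rule half_y_nonzero)
  have e: "e1 = x - r1\<^sup>2" "e2 = x - r2\<^sup>2" "e3 = x - r3\<^sup>2" using assms by (auto simp: roots_def)
  have x: "3 * x = r1\<^sup>2 + r2\<^sup>2 + r3\<^sup>2"
    using sum_zero unfolding e by Groebner_Basis.algebra
  have "3 * ?X\<^sup>2 + A = (?X - e1) * (?X - e2) + (?X - e1) * (?X - e3) + (?X - e2) * (?X - e3)"
    unfolding A_def by (simp add: e3_eq power2_eq_square algebra_simps)
  also have "\<dots> = ?m * (2 * ?Y)"
    unfolding half_x_diffs[OF assms] half_y_def by (simp add: algebra_simps)
  finally have m: "(3 * ?X\<^sup>2 + A) / (2 * ?Y) = ?m" using y by simp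
  have "3 * (?m\<^sup>2 - ?X - ?X) = 3 * x" 
    using x unfolding half_x_def unfolding e by Groebner_Basis.algebra
  then have X: "?m\<^sup>2 - ?X - ?X = x" by (simp only: mult_cancel_left) simp
  have Xx: "?X - x = r1 * r2 + r1 * r3 + r2 * r3"
    unfolding half_x_def by (simp add: e power2_eq_square algebra_simps)
  have "?m * (?X - x) - ?Y = r1 * r2 * r3"
    unfolding Xx half_y_def by (simp add: algebra_simps)
  then show ?thesis using y unfolding ell_add.simps Let_def by (simp add: m X)
qed

text \<open>The sums \<open>r\<^sub>i + r\<^sub>j\<close> of the square roots can be read off from the point \<open>(x, y)\<close>: they are
  \<open>(x - e\<^sub>i) (x - e\<^sub>j) / y\<close>.\<close>

lemma ex_half:
  assumes "on_curve (Pt x y)" "y \<noteq> 0"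
  obtains z r1 r2 r3 where "roots z r1 r2 r3" "Pt x y = half r1 r2 r3"
proof -
  have y2: "y\<^sup>2 = (x - e1) * (x - e2) * (x - e3)" using assms(1) on_curve_iff by blast
  then have ne: "x - e1 \<noteq> 0" "x - e2 \<noteq> 0" "x - e3 \<noteq> 0" using assms(2) by auto
  define p1 where "p1 = x - e1"
  define p2 where "p2 = x - e2"
  define p3 where "p3 = x - e3"
  note p = p1_def p2_def p3_def
  have p0: "p1 \<noteq> 0" "p2 \<noteq> 0" "p3 \<noteq> 0" and y2: "y\<^sup>2 = p1 * p2 * p3" using ne y2 by (simp_all add: p)
  define s12 where "s12 = p1 * p2 / y"
  define s13 where "s13 = p1 * p3 / y"
  define s23 where "s23 = p2 * p3 / y"
  have prods: "s12 * s13 = p1" "s12 * s23 = p2" "s13 * s23 = p3"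
    using assms(2) p0 y2 by (simp_all add: s12_def s13_def s23_def field_simps power2_eq_square)
  have prod3: "p1 * s23 = y"
    using assms(2) y2 by (simp add: s23_def field_simps power2_eq_square)
  define r1 where "r1 = (s12 + s13 - s23) / 2"
  define r2 where "r2 = (s12 + s23 - s13) / 2"
  define r3 where "r3 = (s13 + s23 - s12) / 2"
  have s: "r1 + r2 = s12" "r1 + r3 = s13" "r2 + r3 = s23"
    by (simp_all add: r1_def r2_def r3_def field_simps)
  define z where "z = r1\<^sup>2 + e1"
  have r1: "r1\<^sup>2 = z - e1" by (simp add: z_def)
  have "r1\<^sup>2 - r2\<^sup>2 = s12 * s13 - s12 * s23"
    unfolding s[symmetric] by (simp add: power2_eq_square algebra_simps)
  then have r2: "r2\<^sup>2 = z - e2" unfolding prods p z_def by (simp add: algebra_simps)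
  have "r1\<^sup>2 - r3\<^sup>2 = s12 * s13 - s13 * s23"
    unfolding s[symmetric] by (simp add: power2_eq_square algebra_simps)
  then have r3: "r3\<^sup>2 = z - e3" unfolding prods p z_def by (simp add: algebra_simps)
  have "roots z r1 r2 r3" using r1 r2 r3 by (simp add: roots_def)
  moreover have "Pt x y = half r1 r2 r3"
    by (simp add: half_x_def half_y_def s prods prod3) (simp add: p1_def)
  ultimately show ?thesis using that by blast
qed

lemma mult_2_eq_infinity_iff:
  assumes "on_curve P"
  shows "ell_mult A 2 P = Pt_infinity
    \<longleftrightarrow> P = Pt_infinity \<or> (\<exists>e\<in>{e1, e2, e3}. P = Pt e 0)"
proof (cases P)
  case (Pt x y)
  have "ell_mult A 2 P = Pt_infinity \<longleftrightarrow> y = 0"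
    using Pt by (simp add: mult_double Let_def)
  also have "\<dots> \<longleftrightarrow> y = 0 \<and> x \<in> {e1, e2, e3}"
    using assms unfolding Pt on_curve_iff by auto
  finally show ?thesis using Pt by auto
qed (simp add: mult_double)

lemma mult_4_eq_infinity_iff:
  assumes "on_curve P"
  shows "ell_mult A 4 P = Pt_infinity \<longleftrightarrow> ell_mult A 2 P = Pt_infinity
    \<or> (\<exists>e\<in>{e1, e2, e3}. \<exists>r1 r2 r3. roots e r1 r2 r3 \<and> P = half r1 r2 r3)"
proof -
  have "ell_mult A 4 P = Pt_infinity \<longleftrightarrow> ell_mult A 2 (P \<boxplus> P) = Pt_infinity"
    using assms by (simp add: mult_quadruple mult_double)
  also have "\<dots> \<longleftrightarrow> P \<boxplus> P = Pt_infinity \<or> (\<exists>e\<in>{e1, e2, e3}. P \<boxplus> P = Pt e 0)"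
    using assms by (simp add: mult_2_eq_infinity_iff)
  also have "(\<exists>e\<in>{e1, e2, e3}. P \<boxplus> P = Pt e 0) \<longleftrightarrow>
    (\<exists>e\<in>{e1, e2, e3}. \<exists>r1 r2 r3. roots e r1 r2 r3 \<and> P = half r1 r2 r3)" (is "?l \<longleftrightarrow> ?r")
  proof
    assume ?l
    then obtain e where e: "e \<in> {e1, e2, e3}" "P \<boxplus> P = Pt e 0" by blast
    obtain x y where P: "P = Pt x y" using e(2) by (cases P) auto
    have "y \<noteq> 0" using e(2) P by auto
    then obtain z r1 r2 r3 where r: "roots z r1 r2 r3" "P = half r1 r2 r3"
      using ex_half assms P by metis
    have "z = e" using double_half[OF r(1)] e(2) r(2) by simp
    then show ?r using r e by blast
  next
    assume ?r
    then obtain e r1 r2 r3 where e: "e \<in> {e1, e2, e3}" and r: "roots e r1 r2 r3" "P = half r1 r2 r3"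
      by blast
    have "r1 = 0 \<or> r2 = 0 \<or> r3 = 0" using e r(1) by (auto simp: roots_def)
    then have "P \<boxplus> P = Pt e 0" using double_half[OF r(1)] r(2) by auto
    then show ?l using e by blast
  qed
  finally show ?thesis by (simp add: mult_double)
qed

lemma mult_8_eq_infinity_iff:
  assumes "on_curve P"
  shows "ell_mult A 8 P = Pt_infinity \<longleftrightarrow> ell_mult A 4 P = Pt_infinity
    \<or> (\<exists>e\<in>{e1, e2, e3}. \<exists>s1 s2 s3 r1 r2 r3. roots e s1 s2 s3
          \<and> roots (half_x s1 s2 s3) r1 r2 r3 \<and> r1 * r2 * r3 = half_y s1 s2 s3
          \<and> P = half r1 r2 r3)"
proof -
  have "ell_mult A 8 P = Pt_infinity \<longleftrightarrow> ell_mult A 4 P = ell_neg (ell_mult A 4 P)"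
    using mult_double_eq_infinity_iff[OF assms, of 4] by simp
  also have "\<dots> \<longleftrightarrow> ell_mult A 4 (P \<boxplus> P) = Pt_infinity"
    using assms by (simp add: mult_quadruple ell_add_eq_infinity_iff)
  also have "\<dots> \<longleftrightarrow> ell_mult A 2 (P \<boxplus> P) = Pt_infinity
    \<or> (\<exists>e\<in>{e1, e2, e3}. \<exists>s1 s2 s3. roots e s1 s2 s3 \<and> P \<boxplus> P = half s1 s2 s3)"
    using assms by (simp add: mult_4_eq_infinity_iff)
  also have "ell_mult A 2 (P \<boxplus> P) = Pt_infinity \<longleftrightarrow> ell_mult A 4 P = Pt_infinity"
    using assms by (simp add: mult_quadruple mult_double)
  also have "(\<exists>e\<in>{e1, e2, e3}. \<exists>s1 s2 s3. roots e s1 s2 s3 \<and> P \<boxplus> P = half s1 s2 s3) \<longleftrightarrow>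
    (\<exists>e\<in>{e1, e2, e3}. \<exists>s1 s2 s3 r1 r2 r3. roots e s1 s2 s3
          \<and> roots (half_x s1 s2 s3) r1 r2 r3 \<and> r1 * r2 * r3 = half_y s1 s2 s3
          \<and> P = half r1 r2 r3)" (is "?l \<longleftrightarrow> ?r")
  proof
    assume ?l
    then obtain e s1 s2 s3 where e: "e \<in> {e1, e2, e3}" "roots e s1 s2 s3" "P \<boxplus> P = half s1 s2 s3"
      by blast
    obtain x y where P: "P = Pt x y" using e(3) by (cases P) auto
    have "y \<noteq> 0" using e(3) P by auto
    then obtain z r1 r2 r3 where r: "roots z r1 r2 r3" "P = half r1 r2 r3"
      using ex_half assms P by metis
    have "z = half_x s1 s2 s3" "r1 * r2 * r3 = half_y s1 s2 s3"
      using double_half[OF r(1)] e(3) r(2) by simp_all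
    then show ?r using r e by blast
  next
    assume ?r
    then show ?l using double_half by metis
  qed
  finally show ?thesis .
qed

end

section \<open>The tower of quadratic extensions\<close>

text \<open>
  Fixed generators, all real and positive. The fields \<open>F1, \<dots>, F5\<close> adjoin \<open>w0\<close>, \<open>\<i>\<close>, \<open>s0\<close>, \<open>q0\<close>, \<open>t0\<close>
  one after the other.
\<close>

definition w0 :: complex where "w0 = complex_of_real (sqrt 2)"
definition s0 :: complex where "s0 = complex_of_real (sqrt (sqrt 2 - 1))"
definition q0 :: complex where "q0 = complex_of_real (sqrt (sqrt 2))"
definition t0 :: complex where "t0 = complex_of_real (sqrt (sqrt (sqrt 2 - 1)))"

lemma w0_sq: "w0\<^sup>2 = 2"
  by (simp add: w0_def flip: of_real_power)

lemma s0_sq: "s0\<^sup>2 = w0 - 1"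
  by (simp add: w0_def s0_def flip: of_real_power)

lemma q0_sq: "q0\<^sup>2 = w0"
  by (simp add: w0_def q0_def flip: of_real_power)

lemma t0_sq: "t0\<^sup>2 = s0"
  by (simp add: s0_def t0_def flip: of_real_power)

definition F1 :: "complex set" where "F1 = quad_ext \<rat> w0"
definition F2 :: "complex set" where "F2 = quad_ext F1 \<i>"
definition F3 :: "complex set" where "F3 = quad_ext F2 s0"
definition F4 :: "complex set" where "F4 = quad_ext F3 q0"
definition F5 :: "complex set" where "F5 = quad_ext F4 t0"

interpretation F1: complex_subfield F1
  unfolding F1_def by (rule complex_subfield.complex_subfield_quad_ext) (auto simp: complex_subfield_Rats w0_sq)

lemma w0_in_F1 [simp]: "w0 \<in> F1"
  unfolding F1_def by (rule complex_subfield.generator_in_quad_ext[OF complex_subfield_Rats])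

interpretation F2: complex_subfield F2
  unfolding F2_def by (rule F1.complex_subfield_quad_ext) auto

lemma F1_subset_F2: "F1 \<subseteq> F2" unfolding F2_def by (rule F1.subset_quad_ext)

lemma w0_i_in_F2 [simp]: "w0 \<in> F2" "\<i> \<in> F2"
  using F1_subset_F2 F1.generator_in_quad_ext[of \<i>] by (auto simp: F2_def)

interpretation F3: complex_subfield F3
  unfolding F3_def by (rule F2.complex_subfield_quad_ext) (auto simp: s0_sq)

lemma F2_subset_F3: "F2 \<subseteq> F3" unfolding F3_def by (rule F2.subset_quad_ext)

lemma w0_i_s0_in_F3 [simp]: "w0 \<in> F3" "\<i> \<in> F3" "s0 \<in> F3"
  using F2_subset_F3 F2.generator_in_quad_ext[of s0] by (auto simp: F3_def)

interpretation F4: complex_subfield F4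
  unfolding F4_def by (rule F3.complex_subfield_quad_ext) (auto simp: q0_sq)

lemma F3_subset_F4: "F3 \<subseteq> F4" unfolding F4_def by (rule F3.subset_quad_ext)

lemma w0_i_s0_q0_in_F4 [simp]: "w0 \<in> F4" "\<i> \<in> F4" "s0 \<in> F4" "q0 \<in> F4"
  using F3_subset_F4 F3.generator_in_quad_ext[of q0] by (auto simp: F4_def)

interpretation F5: complex_subfield F5
  unfolding F5_def by (rule F4.complex_subfield_quad_ext) (auto simp: t0_sq)

lemma F4_subset_F5: "F4 \<subseteq> F5" unfolding F5_def by (rule F4.subset_quad_ext)

lemma generators_in_F5 [simp]: "w0 \<in> F5" "\<i> \<in> F5" "s0 \<in> F5" "q0 \<in> F5" "t0 \<in> F5"
  using F4_subset_F5 F4.generator_in_quad_ext[of t0] by (auto simp: F5_def)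

lemma F1_minimal: "\<lbrakk>complex_subfield K; w0 \<in> K\<rbrakk> \<Longrightarrow> F1 \<subseteq> K"
  unfolding F1_def
  by (rule complex_subfield.quad_ext_subset[OF complex_subfield_Rats])
     (auto intro: complex_subfield.Rats_subset[THEN subsetD])

lemma F3_minimal:
  assumes "complex_subfield K" "w0 \<in> K" "\<i> \<in> K" "s0 \<in> K"
  shows "F3 \<subseteq> K"
proof -
  have "F1 \<subseteq> K" using assms by (intro F1_minimal)
  then have "F2 \<subseteq> K" using assms F1.quad_ext_subset[of K \<i>] by (simp add: F2_def)
  then show ?thesis using assms F2.quad_ext_subset[of K s0] by (simp add: F3_def)
qed

lemma F5_minimal:
  assumes "complex_subfield K" "\<i> \<in> K" "q0 \<in> K" "t0 \<in> K"
  shows "F5 \<subseteq> K"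
proof -
  interpret complex_subfield K by fact
  have "w0 \<in> K" using power_closed[OF assms(3), of 2] by (simp add: q0_sq)
  moreover have "s0 \<in> K" using power_closed[OF assms(4), of 2] by (simp add: t0_sq)
  ultimately have "F3 \<subseteq> K" using F3_minimal assms by blast
  then have "F4 \<subseteq> K" using assms F3.quad_ext_subset[of K q0] by (simp add: F4_def)
  then show ?thesis using assms F4.quad_ext_subset[of K t0] by (simp add: F5_def)
qed

subsection \<open>Non-squares\<close>

lemma sq_eq_2_sq_rat:
  fixes x y :: rat
  assumes "x\<^sup>2 = 2 * y\<^sup>2"
  shows "y = 0"
proof (rule ccontr)
  assume "y \<noteq> 0"
  define z :: real where "z = of_rat (x / y)"
  have "(x / y)\<^sup>2 = 2" using assms \<open>y \<noteq> 0\<close> by (simp add: power_divide)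
  then have "(of_rat ((x / y)\<^sup>2) :: real) = of_rat 2" by simp
  then have "z\<^sup>2 = 2" by (simp add: z_def of_rat_power)
  then have "sqrt 2 = \<bar>z\<bar>" by (intro real_sqrt_unique) auto
  moreover have "z \<in> \<rat>" by (simp add: z_def)
  ultimately have "sqrt 2 \<in> \<rat>" by simp
  moreover have "algebraic_int (sqrt 2)" by (intro algebraic_int_sqrt int_imp_algebraic_int) simp
  ultimately have "sqrt 2 \<in> \<int>" by (intro rational_algebraic_int_is_int)
  then obtain k where k: "sqrt 2 = of_int k" by (auto elim: Ints_cases)
  have "1 < sqrt 2" "sqrt 2 < 2" by (simp_all add: real_less_lsqrt)
  with k have "1 < k" "k < 2" by simp_all
  then show False by simp
qed

lemma w0_irrational: "w0 \<notin> \<rat>"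
proof
  assume "w0 \<in> \<rat>"
  then obtain r where r: "w0 = of_rat r" by (auto elim: Rats_cases)
  have "of_rat (r\<^sup>2) = (of_rat 2 :: complex)" using w0_sq r by (simp add: of_rat_power)
  then have "r\<^sup>2 = 2 * 1\<^sup>2" by (simp only: of_rat_eq_iff) simp
  then show False using sq_eq_2_sq_rat by fastforce
qed

text \<open>Compare coordinates in \<open>(a + b w0)^2 = x + y w0\<close>.\<close>

lemma square_in_F1:
  assumes "v \<in> F1" "v\<^sup>2 = of_rat x + of_rat y * w0"
  obtains a b where "a\<^sup>2 + 2 * b\<^sup>2 = x" "2 * a * b = y"
proof -
  obtain a b where v: "v = of_rat a + of_rat b * w0"
    using assms(1) unfolding F1_def by (auto elim!: quad_extE Rats_cases)
  have "(x + y * w0)\<^sup>2 = (x\<^sup>2 + y\<^sup>2 * w0\<^sup>2) + (2 * x * y) * w0" for x y :: complex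
    by (simp add: power2_eq_square algebra_simps)
  note sq = this[unfolded w0_sq]
  have "v\<^sup>2 = of_rat (a\<^sup>2 + 2 * b\<^sup>2) + of_rat (2 * a * b) * w0"
    using sq[of "of_rat a" "of_rat b"] unfolding v
    by (simp add: of_rat_add of_rat_mult of_rat_power)
  with assms(2) have "of_rat (a\<^sup>2 + 2 * b\<^sup>2) = (of_rat x :: complex)"
    "of_rat (2 * a * b) = (of_rat y :: complex)"
    using complex_subfield.quad_ext_coords[OF complex_subfield_Rats w0_irrational,
        of "of_rat (a\<^sup>2 + 2 * b\<^sup>2)" "of_rat (2 * a * b)" "of_rat x" "of_rat y"] by auto
  then show ?thesis using that[of a b] by (simp only: of_rat_eq_iff)
qed

text \<open>
  With \<open>a^2 + 2 b^2\<close> and \<open>2 a b\<close> prescribed, the square \<open>(a^2 - 2 b^2)^2\<close>, which is the norm of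
  \<open>(a + b w0)^2\<close>, is prescribed as well; it would be \<open>- r^2\<close> in the first case and \<open>2 r^2\<close> in the
  third. The arbitrary rational factor \<open>r\<close> is there because squares of the larger fields of
  the tower descend to \<open>\<plusminus>d\<close> times these elements.
\<close>

lemma not_square_F1:
  assumes "r \<noteq> 0" "v \<in> F1"
  shows "v\<^sup>2 \<noteq> of_rat r * (w0 - 1)" "v\<^sup>2 \<noteq> of_rat r * w0" "v\<^sup>2 \<noteq> of_rat r * w0 * (w0 - 1)"
proof -
  have norm: "(a\<^sup>2 - 2 * b\<^sup>2)\<^sup>2 = (a\<^sup>2 + 2 * b\<^sup>2)\<^sup>2 - 2 * (2 * a * b)\<^sup>2" for a b :: rat
    by (simp add: power2_eq_square algebra_simps)
  show "v\<^sup>2 \<noteq> of_rat r * (w0 - 1)"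
  proof
    assume "v\<^sup>2 = of_rat r * (w0 - 1)"
    then have "v\<^sup>2 = of_rat (- r) + of_rat r * w0" by (simp add: algebra_simps of_rat_minus)
    then obtain a b where "a\<^sup>2 + 2 * b\<^sup>2 = - r" "2 * a * b = r"
      using square_in_F1[OF assms(2)] by metis
    then have "(a\<^sup>2 - 2 * b\<^sup>2)\<^sup>2 = - r\<^sup>2" using norm[of a b] by simp
    moreover have "r\<^sup>2 > 0" "0 \<le> (a\<^sup>2 - 2 * b\<^sup>2)\<^sup>2" using assms(1) by simp_all
    ultimately show False by linarith
  qed
  show "v\<^sup>2 \<noteq> of_rat r * w0"
  proof
    assume "v\<^sup>2 = of_rat r * w0"
    then have "v\<^sup>2 = of_rat 0 + of_rat r * w0" by simp
    then obtain a b where "a\<^sup>2 + 2 * b\<^sup>2 = 0" "2 * a * b = r"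
      using square_in_F1[OF assms(2)] by metis
    moreover have "0 \<le> a\<^sup>2" "0 \<le> b\<^sup>2" by simp_all
    ultimately have "b\<^sup>2 = 0" by linarith
    then show False using \<open>2 * a * b = r\<close> assms(1) by simp
  qed
  show "v\<^sup>2 \<noteq> of_rat r * w0 * (w0 - 1)"
  proof
    assume "v\<^sup>2 = of_rat r * w0 * (w0 - 1)"
    moreover have "x * w0 * (w0 - 1) = x * w0\<^sup>2 + (- x) * w0" for x :: complex
      by (simp add: power2_eq_square algebra_simps)
    from this[unfolded w0_sq] have "of_rat r * w0 * (w0 - 1) = of_rat (2 * r) + of_rat (- r) * w0"
      by (simp add: of_rat_minus of_rat_mult)
    ultimately have "v\<^sup>2 = of_rat (2 * r) + of_rat (- r) * w0" by simp
    then obtain a b where "a\<^sup>2 + 2 * b\<^sup>2 = 2 * r" "2 * a * b = - r"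
      using square_in_F1[OF assms(2)] by metis
    then have "(a\<^sup>2 - 2 * b\<^sup>2)\<^sup>2 = 2 * r\<^sup>2" using norm[of a b] by (simp add: power_mult_distrib)
    then show False using sq_eq_2_sq_rat assms(1) by blast
  qed
qed

lemma i_not_in_F1: "\<i> \<notin> F1"
proof
  assume i: "\<i> \<in> F1"
  have "\<i>\<^sup>2 = of_rat (- 1) + of_rat 0 * w0" by (simp add: of_rat_minus)
  then obtain a b :: rat where "a\<^sup>2 + 2 * b\<^sup>2 = - 1"
    using square_in_F1[OF i] by metis
  moreover have "0 \<le> a\<^sup>2" "0 \<le> b\<^sup>2" by simp_all
  ultimately show False by linarith
qed

lemma square_in_F2:
  assumes "y \<in> F2" "y\<^sup>2 \<in> F1"
  obtains z where "z \<in> F1" "y\<^sup>2 = z\<^sup>2 \<or> y\<^sup>2 = - z\<^sup>2"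
  using F1.square_in_quad_ext[of \<i> y] assms i_not_in_F1 by (auto simp: F2_def)

lemma not_square_F2:
  assumes "r \<noteq> 0" "v \<in> F2"
  shows "v\<^sup>2 \<noteq> of_rat r * (w0 - 1)" "v\<^sup>2 \<noteq> of_rat r * w0" "v\<^sup>2 \<noteq> of_rat r * w0 * (w0 - 1)"
proof -
  have *: "v\<^sup>2 \<noteq> of_rat r * g"
    if g: "g \<in> F1" "\<And>r v. r \<noteq> 0 \<Longrightarrow> v \<in> F1 \<Longrightarrow> v\<^sup>2 \<noteq> of_rat r * g" for g
  proof
    assume v: "v\<^sup>2 = of_rat r * g"
    then have "v\<^sup>2 \<in> F1" using g(1) by simp
    then obtain z where z: "z \<in> F1" "v\<^sup>2 = z\<^sup>2 \<or> v\<^sup>2 = - z\<^sup>2" using square_in_F2 assms(2) by metis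
    then have "z\<^sup>2 = of_rat r * g \<or> z\<^sup>2 = of_rat (- r) * g"
      using v by (auto simp: of_rat_minus)
    then show False using g(2) assms(1) z(1) by (metis neg_equal_0_iff_equal)
  qed
  show "v\<^sup>2 \<noteq> of_rat r * (w0 - 1)"
    by (rule *) (simp, rule not_square_F1(1))
  show "v\<^sup>2 \<noteq> of_rat r * w0"
    by (rule *) (simp, rule not_square_F1(2))
  have "v\<^sup>2 \<noteq> of_rat r * (w0 * (w0 - 1))"
    using not_square_F1(3) by (intro *) (simp_all add: mult.assoc)
  then show "v\<^sup>2 \<noteq> of_rat r * w0 * (w0 - 1)" by (simp add: mult.assoc)
qed

lemma s0_not_in_F2: "s0 \<notin> F2"
  using not_square_F2(1)[of 1 s0] s0_sq by auto

lemma square_in_F3: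
  assumes "y \<in> F3" "y\<^sup>2 \<in> F2"
  obtains z where "z \<in> F2" "y\<^sup>2 = z\<^sup>2 \<or> y\<^sup>2 = z\<^sup>2 * (w0 - 1)"
  using F2.square_in_quad_ext[of s0 y] assms s0_not_in_F2 by (auto simp: F3_def s0_sq)

lemma rat_w0_not_square_F3:
  assumes "r \<noteq> 0" "v \<in> F3"
  shows "v\<^sup>2 \<noteq> of_rat r * w0"
proof
  assume v: "v\<^sup>2 = of_rat r * w0"
  then have "v\<^sup>2 \<in> F2" by simp
  then obtain z where z: "z \<in> F2" "v\<^sup>2 = z\<^sup>2 \<or> v\<^sup>2 = z\<^sup>2 * (w0 - 1)"
    using square_in_F3 assms(2) by metis
  moreover have "(z * (w0 - 1))\<^sup>2 = (z\<^sup>2 * (w0 - 1)) * (w0 - 1)" by (simp add: power2_eq_square)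
  ultimately have "z\<^sup>2 = of_rat r * w0 \<or> (z * (w0 - 1))\<^sup>2 = of_rat r * w0 * (w0 - 1)"
    using v by metis
  then show False using not_square_F2(2,3)[OF assms(1)] z(1) by auto
qed

text \<open>
  The norm from \<open>F3\<close> to \<open>F2\<close> of \<open>g s0\<close> is \<open>g^2 (1 - w0)\<close>, so a square root of \<open>g s0\<close>
  would make \<open>1 - w0\<close> a square in \<open>F2\<close>.
\<close>

lemma mult_s0_not_square_F3:
  assumes "g \<in> F2" "g \<noteq> 0" "v \<in> F3"
  shows "v\<^sup>2 \<noteq> g * s0"
proof
  assume v: "v\<^sup>2 = g * s0"
  obtain a b where ab: "a \<in> F2" "b \<in> F2" and v': "v = a + b * s0"
    using assms(3) unfolding F3_def by (rule quad_extE)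
  have "(a + b * s)\<^sup>2 = (a\<^sup>2 + b\<^sup>2 * s\<^sup>2) + (2 * a * b) * s" for s
    by (simp add: power2_eq_square algebra_simps)
  then have "(a\<^sup>2 + b\<^sup>2 * (w0 - 1)) + (2 * a * b) * s0 = 0 + g * s0"
    using v unfolding v' by (metis s0_sq add_0)
  then have 0: "a\<^sup>2 + b\<^sup>2 * (w0 - 1) = 0" "2 * a * b = g"
    using F2.quad_ext_coords[OF s0_not_in_F2, of "a\<^sup>2 + b\<^sup>2 * (w0 - 1)" "2 * a * b" 0 g]
      ab assms(1) by auto
  then have "b \<noteq> 0" using assms(2) by auto
  have "a\<^sup>2 = - (b\<^sup>2 * (w0 - 1))" using 0(1) by (simp add: eq_neg_iff_add_eq_0)
  then have "(a / b)\<^sup>2 = of_rat (- 1) * (w0 - 1)"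
    using \<open>b \<noteq> 0\<close> by (simp add: power_divide of_rat_minus)
  then show False using not_square_F2(1)[of "- 1" "a / b"] ab by simp
qed

lemma q0_not_in_F3: "q0 \<notin> F3"
  using rat_w0_not_square_F3[of 1 q0] q0_sq by auto

lemma square_in_F4:
  assumes "y \<in> F4" "y\<^sup>2 \<in> F3"
  obtains z where "z \<in> F3" "y\<^sup>2 = z\<^sup>2 \<or> y\<^sup>2 = z\<^sup>2 * w0"
  using F3.square_in_quad_ext[of q0 y] assms q0_not_in_F3 by (auto simp: F4_def q0_sq)

lemma rat_s0_not_square_F4:
  assumes "r \<noteq> 0" "v \<in> F4"
  shows "v\<^sup>2 \<noteq> of_rat r * s0"
proof
  assume v: "v\<^sup>2 = of_rat r * s0"
  then have "v\<^sup>2 \<in> F3" by simp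
  then obtain z where z: "z \<in> F3" "v\<^sup>2 = z\<^sup>2 \<or> v\<^sup>2 = z\<^sup>2 * w0"
    using square_in_F4 assms(2) by metis
  moreover have "(z * w0)\<^sup>2 = (z\<^sup>2 * w0) * w0" by (simp add: power2_eq_square)
  ultimately have "z\<^sup>2 = of_rat r * s0 \<or> (z * w0)\<^sup>2 = of_rat r * w0 * s0"
    using v by (metis mult.commute mult.assoc)
  moreover have "w0 \<noteq> 0" using w0_sq by fastforce
  ultimately show False
    using mult_s0_not_square_F3[of "of_rat r" z] mult_s0_not_square_F3[of "of_rat r * w0" "z * w0"]
      z(1) assms(1) by auto
qed

lemma t0_not_in_F4: "t0 \<notin> F4"
  using rat_s0_not_square_F4[of 1 t0] t0_sq by auto

text \<open>Descend through the tower to \<open>F1\<close>; for the extensions by \<open>t0\<close>, \<open>q0\<close> and \<open>s0\<close> the second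
  alternative is excluded by the non-squares above.\<close>

lemma rat_square_in_F5:
  assumes "y \<in> F5" "y\<^sup>2 = of_rat r" "r \<noteq> 0"
  obtains a where "\<bar>r\<bar> = a\<^sup>2 \<or> \<bar>r\<bar> = 2 * a\<^sup>2"
proof -
  have "y\<^sup>2 \<in> F4" using assms(2) by simp
  then obtain y4 where y4: "y4 \<in> F4" "y\<^sup>2 = y4\<^sup>2 \<or> y\<^sup>2 = y4\<^sup>2 * s0"
    using F4.square_in_quad_ext[of t0 y] assms(1) t0_not_in_F4 by (auto simp: F5_def t0_sq)
  have "y\<^sup>2 \<noteq> y4\<^sup>2 * s0"
  proof
    assume "y\<^sup>2 = y4\<^sup>2 * s0"
    moreover have "(y4 * s0)\<^sup>2 = (y4\<^sup>2 * s0) * s0" by (simp add: power2_eq_square)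
    ultimately have "(y4 * s0)\<^sup>2 = of_rat r * s0" using assms(2) by simp
    then show False using rat_s0_not_square_F4[OF assms(3), of "y4 * s0"] y4(1) by simp
  qed
  with y4 have y4': "y4\<^sup>2 = of_rat r" using assms(2) by simp
  then have "y4\<^sup>2 \<in> F3" by simp
  then obtain y3 where y3: "y3 \<in> F3" "y4\<^sup>2 = y3\<^sup>2 \<or> y4\<^sup>2 = y3\<^sup>2 * w0"
    using square_in_F4 y4(1) by metis
  have "y4\<^sup>2 \<noteq> y3\<^sup>2 * w0"
  proof
    assume "y4\<^sup>2 = y3\<^sup>2 * w0"
    moreover have "(y3 * w0)\<^sup>2 = (y3\<^sup>2 * w0) * w0" by (simp add: power2_eq_square)
    ultimately have "(y3 * w0)\<^sup>2 = of_rat r * w0" using y4' by simp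
    then show False using rat_w0_not_square_F3[OF assms(3), of "y3 * w0"] y3(1) by simp
  qed
  with y3 have y3': "y3\<^sup>2 = of_rat r" using y4' by simp
  then have "y3\<^sup>2 \<in> F2" by simp
  then obtain y2 where y2: "y2 \<in> F2" "y3\<^sup>2 = y2\<^sup>2 \<or> y3\<^sup>2 = y2\<^sup>2 * (w0 - 1)"
    using square_in_F3 y3(1) by metis
  have "y3\<^sup>2 \<noteq> y2\<^sup>2 * (w0 - 1)"
  proof
    assume "y3\<^sup>2 = y2\<^sup>2 * (w0 - 1)"
    moreover have "(y2 * (w0 - 1))\<^sup>2 = (y2\<^sup>2 * (w0 - 1)) * (w0 - 1)"
      by (simp add: power2_eq_square)
    ultimately have "(y2 * (w0 - 1))\<^sup>2 = of_rat r * (w0 - 1)" using y3' by simp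
    then show False using not_square_F2(1)[OF assms(3), of "y2 * (w0 - 1)"] y2(1) by simp
  qed
  with y2 have y2': "y2\<^sup>2 = of_rat r" using y3' by simp
  then have "y2\<^sup>2 \<in> F1" by simp
  then obtain y1 where y1: "y1 \<in> F1" "y2\<^sup>2 = y1\<^sup>2 \<or> y2\<^sup>2 = - y1\<^sup>2"
    using square_in_F2 y2(1) by metis
  then obtain r' where r': "r' = r \<or> r' = - r" "y1\<^sup>2 = of_rat r'"
    using y2' by (metis add.inverse_inverse of_rat_minus)
  then have "y1\<^sup>2 = of_rat r' + of_rat 0 * w0" by simp
  then obtain a b where ab: "a\<^sup>2 + 2 * b\<^sup>2 = r'" "2 * a * b = 0"
    using square_in_F1[OF y1(1)] by metis
  then have "r' = a\<^sup>2 \<or> r' = 2 * b\<^sup>2" by auto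
  moreover have "r' \<ge> 0" using ab(1) by auto
  ultimately have "\<bar>r\<bar> = a\<^sup>2 \<or> \<bar>r\<bar> = 2 * b\<^sup>2" using r'(1) by auto
  then show ?thesis using that by blast
qed

lemma rat_sq_eq_int:
  fixes x :: rat
  assumes "x\<^sup>2 = of_int m"
  obtains k :: int where "m = k\<^sup>2"
proof -
  obtain p n where pn: "quotient_of x = (p, n)" by (cases "quotient_of x")
  note x = quotient_of_div[OF pn] quotient_of_denom_pos[OF pn] quotient_of_coprime[OF pn]
  have "of_int (p\<^sup>2) = (of_int (m * n\<^sup>2) :: rat)"
    using assms x(1,2) by (simp add: power_divide field_simps)
  then have eq: "p\<^sup>2 = m * n\<^sup>2" by (simp only: of_int_eq_iff)
  then have "n\<^sup>2 dvd p\<^sup>2" by simp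
  moreover have "coprime (p\<^sup>2) (n\<^sup>2)" using x(3) by simp
  ultimately have "is_unit (n\<^sup>2)" by (meson coprime_common_divisor dvd_refl)
  then have "n\<^sup>2 = 1" by (simp add: is_unit_power_iff)
  then show ?thesis using eq that[of p] by simp
qed

lemma squarefree_square_in_F5:
  fixes d :: int
  assumes "d \<noteq> 0" "squarefree d" "y \<in> F5" "y\<^sup>2 = of_int d"
  shows "d \<in> {1, -1, 2, -2}"
proof -
  obtain a where a: "\<bar>of_int d\<bar> = a\<^sup>2 \<or> \<bar>of_int d\<bar> = 2 * (a :: rat)\<^sup>2"
  proof (rule rat_square_in_F5)
    show "y \<in> F5" "y\<^sup>2 = of_rat (of_int d)" "(of_int d :: rat) \<noteq> 0" using assms by simp_all
  qed
  show ?thesis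
  proof (cases "\<bar>of_int d\<bar> = a\<^sup>2")
    case True
    then have "a\<^sup>2 = of_int \<bar>d\<bar>" by simp
    then obtain k where k: "\<bar>d\<bar> = k\<^sup>2" by (rule rat_sq_eq_int)
    then have "k\<^sup>2 dvd d" by (metis dvd_abs_iff dvd_refl)
    then have "is_unit k" using assms(2) unfolding squarefree_def by blast
    then have "k = 1 \<or> k = - 1" by auto
    then have "\<bar>d\<bar> = 1" using k by auto
    then show ?thesis by (simp add: abs_if split: if_splits)
  next
    case False
    then have "(2 * a)\<^sup>2 = of_int (2 * \<bar>d\<bar>)" using a by (simp add: power_mult_distrib)
    then obtain k where k: "2 * \<bar>d\<bar> = k\<^sup>2" by (rule rat_sq_eq_int)
    then have "even (k\<^sup>2)" by (metis dvd_triv_left)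
    then obtain j where j: "k = 2 * j" by auto
    have "k\<^sup>2 = 4 * j\<^sup>2" unfolding j by (simp only: power_mult_distrib) simp
    with k have d: "\<bar>d\<bar> = 2 * j\<^sup>2" by linarith
    then have "j\<^sup>2 dvd d" by (metis dvd_abs_iff dvd_triv_right)
    then have "is_unit j" using assms(2) unfolding squarefree_def by blast
    then have "j = 1 \<or> j = - 1" by auto
    then have "\<bar>d\<bar> = 2" using d by auto
    then show ?thesis by (simp add: abs_if split: if_splits)
  qed
qed

subsection \<open>Degrees\<close>

lemma has_rat_degree_F1: "has_rat_degree F1 2"
  using has_rat_degree_quad_ext[OF complex_subfield_Rats has_rat_degree_Rats, of w0] w0_irrational
  by (simp add: F1_def w0_sq)

lemma has_rat_degree_F2: "has_rat_degree F2 4"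
  using has_rat_degree_quad_ext[OF F1.complex_subfield_axioms has_rat_degree_F1 _ i_not_in_F1]
  by (simp add: F2_def)

lemma has_rat_degree_F3: "has_rat_degree F3 8"
  using has_rat_degree_quad_ext[OF F2.complex_subfield_axioms has_rat_degree_F2 _ s0_not_in_F2]
  by (simp add: F3_def s0_sq)

lemma has_rat_degree_F4: "has_rat_degree F4 16"
  using has_rat_degree_quad_ext[OF F3.complex_subfield_axioms has_rat_degree_F3 _ q0_not_in_F3]
  by (simp add: F4_def q0_sq)

lemma has_rat_degree_F5: "has_rat_degree F5 32"
  using has_rat_degree_quad_ext[OF F4.complex_subfield_axioms has_rat_degree_F4 _ t0_not_in_F4]
  by (simp add: F5_def t0_sq)

section \<open>The division fields\<close>

text \<open>The inverse of \<open>s0\<close>, written as a polynomial in the generators.\<close>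

definition \<sigma>0 :: complex where "\<sigma>0 = s0 * (w0 + 1)"

text \<open>The relations between the generators, oriented so that they rewrite polynomials in the
  generators to their normal form.\<close>

lemma rels:
  "w0 * w0 = 2" "w0 * (w0 * z) = 2 * z" "s0 * s0 = w0 - 1" "s0 * (s0 * z) = (w0 - 1) * z"
  "q0 * q0 = w0" "q0 * (q0 * z) = w0 * z" "t0 * t0 = s0" "t0 * (t0 * z) = s0 * z"
  using w0_sq s0_sq q0_sq t0_sq by (simp_all add: power2_eq_square flip: mult.assoc)

lemma \<sigma>0_mult_s0: "s0 * \<sigma>0 = 1"
  by (simp add: \<sigma>0_def algebra_simps rels)

lemma nonzero: "w0 \<noteq> 0" "s0 \<noteq> 0" "\<sigma>0 \<noteq> 0" "q0 \<noteq> 0" "t0 \<noteq> 0" "w0 + 2 \<noteq> 0" "1 + \<sigma>0 \<noteq> 0"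
  "\<sigma>0 - 1 \<noteq> 0" "q0 * (1 - s0) + w0 \<noteq> 0"
proof -
  show w: "w0 \<noteq> 0" using rels(1) by fastforce
  show "s0 \<noteq> 0" "\<sigma>0 \<noteq> 0" using \<sigma>0_mult_s0 by auto
  then show "t0 \<noteq> 0" using rels(7) by fastforce
  show q: "q0 \<noteq> 0" using w rels(5) by fastforce
  have "(w0 + 2) * (2 - w0) = 2" by (simp add: algebra_simps rels)
  then show "w0 + 2 \<noteq> 0" by auto
  have "(1 + \<sigma>0) * (\<sigma>0 - 1) = w0" by (simp add: \<sigma>0_def algebra_simps rels)
  with w show "1 + \<sigma>0 \<noteq> 0" "\<sigma>0 - 1 \<noteq> 0" by auto
  show "q0 * (1 - s0) + w0 \<noteq> 0"
  proof
    assume "q0 * (1 - s0) + w0 = 0"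
    then have "q0 * (1 - s0 + q0) = 0" by (simp add: algebra_simps rels)
    with q have "1 - s0 + q0 = 0" by simp
    then have s: "s0 = 1 + q0" by (simp add: algebra_simps)
    then have "s0 * s0 = (1 + q0) * (1 + q0)" by simp
    then have "2 * (q0 + 1) = 0" by (simp add: algebra_simps rels)
    then have "q0 + 1 = 0" by (simp only: mult_eq_0_iff) simp
    then have "q0 = - 1" by (simp add: eq_neg_iff_add_eq_0)
    then have "w0 = (- 1) * (- 1)" using rels(5) by metis
    then show False using rels(1) by simp
  qed
qed

text \<open>
  The curve \<open>E^d\<close>, with the parameters of \<^locale>\<open>split_curve\<close> as roots of its cubic,
  and a square root \<open>c\<close> of \<open>d\<close>.
\<close>

locale twist =
  fixes d :: int
  assumes d_nonzero: "d \<noteq> 0"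
begin

definition \<delta> :: complex where "\<delta> = of_int d"

definition c :: complex where "c = csqrt (of_int d)"

definition e1 :: complex where "e1 = 48 * \<delta>"
definition e2 :: complex where "e2 = 36 * \<delta> * w0 - 24 * \<delta>"
definition e3 :: complex where "e3 = - 36 * \<delta> * w0 - 24 * \<delta>"

lemma c_sq: "c\<^sup>2 = \<delta>"
  by (simp add: c_def \<delta>_def)

lemma c_rels: "c * c = \<delta>" "c * (c * z) = \<delta> * z"
  using c_sq by (simp_all add: power2_eq_square flip: mult.assoc)

lemma c_nonzero: "\<delta> \<noteq> 0" "c \<noteq> 0"
  using d_nonzero by (auto simp: \<delta>_def c_def)

text \<open>All differences of the \<open>e\<^sub>i\<close> are squares in \<open>\<rat>(\<i>, w, s, c q)\<close>.\<close>

lemma e_diffs: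
  "e1 - e2 = (6 * (c * q0) * s0)\<^sup>2" "e1 - e3 = (6 * (c * q0) * \<sigma>0)\<^sup>2"
  "e2 - e1 = (6 * \<i> * (c * q0) * s0)\<^sup>2" "e2 - e3 = (6 * (c * q0) * w0)\<^sup>2"
  "e3 - e1 = (6 * \<i> * (c * q0) * \<sigma>0)\<^sup>2" "e3 - e2 = (6 * \<i> * (c * q0) * w0)\<^sup>2"
  by (simp_all add: e1_def e2_def e3_def \<sigma>0_def power2_eq_square algebra_simps rels c_rels)

sublocale split_curve e1 e2 e3
proof
  show "e1 + e2 + e3 = 0" by (simp add: e1_def e2_def e3_def)
  have "e1 - e2 \<noteq> 0" "e1 - e3 \<noteq> 0" "e2 - e3 \<noteq> 0"
    unfolding e_diffs using nonzero c_nonzero by simp_all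
  then show "e1 \<noteq> e2" "e1 \<noteq> e3" "e2 \<noteq> e3" by auto
qed

lemma Ed_coefficients: "A = of_rat (- 4320 * of_int d ^ 2)" "B = of_rat (96768 * of_int d ^ 3)"
proof -
  have "A = - 4320 * \<delta>\<^sup>2" "B = 96768 * \<delta> ^ 3"
    unfolding A_def B_def
    by (simp_all add: e1_def e2_def e3_def power2_eq_square power3_eq_cube algebra_simps rels)
  then show "A = of_rat (- 4320 * of_int d ^ 2)" "B = of_rat (96768 * of_int d ^ 3)"
    by (simp_all add: \<delta>_def of_rat_mult of_rat_minus of_rat_power)
qed

text \<open>Points with coordinates in a number field are algebraic, so the requirement that
  torsion points have coordinates in \<^const>\<open>rat_bar\<close> can be dropped.\<close>

lemma Ed_division_field_eqI:
  assumes K: "complex_subfield K" "has_rat_degree K m"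
    and upper: "\<And>x y. \<lbrakk>on_curve (Pt x y); ell_mult A n (Pt x y) = Pt_infinity\<rbrakk> \<Longrightarrow> x \<in> K \<and> y \<in> K"
    and lower: "\<And>K'. \<lbrakk>complex_subfield K';
      \<And>x y. \<lbrakk>on_curve (Pt x y); ell_mult A n (Pt x y) = Pt_infinity\<rbrakk> \<Longrightarrow> x \<in> K' \<and> y \<in> K'\<rbrakk> \<Longrightarrow> K \<subseteq> K'"
  shows "Ed_division_field d n = K"
proof -
  define T where "T = ell_torsion A B rat_bar n"
  have T_iff: "Pt x y \<in> T \<longleftrightarrow> on_curve (Pt x y) \<and> ell_mult A n (Pt x y) = Pt_infinity" for x y
    using upper[of x y] algebraic_if_has_rat_degree[OF K]
    by (auto simp: T_def ell_torsion_def ell_points_def rat_bar_def)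
  have coords: "z \<in> ell_coords T \<longleftrightarrow> (\<exists>x y. Pt x y \<in> T \<and> (z = x \<or> z = y))" for z
    by (auto simp: ell_coords_def split: ell_point.splits) (metis ell_point.exhaust)+
  have "rat_adjoin (ell_coords T) = K"
  proof (rule rat_adjoin_eqI[OF K(1)])
    show "ell_coords T \<subseteq> K" using upper by (auto simp: coords T_iff)
    show "K \<subseteq> K'" if "complex_subfield K'" "ell_coords T \<subseteq> K'" for K'
    proof (rule lower[OF that(1)])
      fix x y assume "on_curve (Pt x y)" "ell_mult A n (Pt x y) = Pt_infinity"
      then have "Pt x y \<in> T" by (simp only: T_iff)
      then show "x \<in> K' \<and> y \<in> K'" using that(2) coords by blast
    qed
  qed
  then show ?thesis
    by (simp only: Ed_division_field_def division_field_def T_def Ed_coefficients)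
qed

lemma \<delta>_in_subfield: "complex_subfield K \<Longrightarrow> \<delta> \<in> K"
  by (simp add: \<delta>_def complex_subfield.of_int_closed)

lemma e_in_subfield:
  assumes "complex_subfield K" "w0 \<in> K"
  shows "e1 \<in> K" "e2 \<in> K" "e3 \<in> K"
proof -
  interpret complex_subfield K by fact
  show "e1 \<in> K" "e2 \<in> K" "e3 \<in> K"
    using assms(2) \<delta>_in_subfield[OF assms(1)] by (auto simp: e1_def e2_def e3_def)
qed

lemma half_in_subfield:
  assumes "complex_subfield K" "r1 \<in> K" "r2 \<in> K" "r3 \<in> K"
  shows "half_x r1 r2 r3 \<in> K" "half_y r1 r2 r3 \<in> K"
proof -
  interpret complex_subfield K by fact
  show "half_x r1 r2 r3 \<in> K" "half_y r1 r2 r3 \<in> K"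
    using assms \<delta>_in_subfield[OF assms(1)] unfolding half_x_def half_y_def unfolding e1_def by simp_all
qed

lemma torsion_points:
  shows "on_curve (Pt e2 0)" "ell_mult A 2 (Pt e2 0) = Pt_infinity"
    and "\<lbrakk>e \<in> {e1, e2, e3}; roots e r1 r2 r3\<rbrakk> \<Longrightarrow> ell_mult A 4 (half r1 r2 r3) = Pt_infinity"
    and "\<lbrakk>e \<in> {e1, e2, e3}; roots e u1 u2 u3; roots (half_x u1 u2 u3) r1 r2 r3;
      r1 * r2 * r3 = half_y u1 u2 u3\<rbrakk> \<Longrightarrow> ell_mult A 8 (half r1 r2 r3) = Pt_infinity"
proof -
  show on: "on_curve (Pt e2 0)" using on_curve_iff[of e2 0] by simp
  show "ell_mult A 2 (Pt e2 0) = Pt_infinity" unfolding mult_2_eq_infinity_iff[OF on] by blast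
  show "ell_mult A 4 (half r1 r2 r3) = Pt_infinity" if "e \<in> {e1, e2, e3}" "roots e r1 r2 r3"
    unfolding mult_4_eq_infinity_iff[OF on_curve_half[OF that(2)]] using that by metis
  show "ell_mult A 8 (half r1 r2 r3) = Pt_infinity"
    if "e \<in> {e1, e2, e3}" "roots e u1 u2 u3" "roots (half_x u1 u2 u3) r1 r2 r3"
      "r1 * r2 * r3 = half_y u1 u2 u3"
    unfolding mult_8_eq_infinity_iff[OF on_curve_half[OF that(3)]] using that by metis
qed

subsection \<open>The 2-torsion\<close>

theorem Ed_division_field_2: "Ed_division_field d 2 = F1"
proof (rule Ed_division_field_eqI[OF F1.complex_subfield_axioms has_rat_degree_F1])
  fix x y assume "on_curve (Pt x y)" "ell_mult A 2 (Pt x y) = Pt_infinity"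
  then show "x \<in> F1 \<and> y \<in> F1"
    using mult_2_eq_infinity_iff[of "Pt x y"] e_in_subfield[OF F1.complex_subfield_axioms] by auto
next
  fix K assume K: "complex_subfield K"
    and pts: "\<And>x y. \<lbrakk>on_curve (Pt x y); ell_mult A 2 (Pt x y) = Pt_infinity\<rbrakk> \<Longrightarrow> x \<in> K \<and> y \<in> K"
  interpret K: complex_subfield K by fact
  have "e2 \<in> K" using pts[OF torsion_points(1,2)] by simp
  then have "36 * \<delta> * w0 \<in> K"
    using K.add_closed[of e2 "24 * \<delta>"] \<delta>_in_subfield[OF K] by (simp add: e2_def)
  then have "w0 \<in> K"
    using K.mult_left_cancel_closed[of "36 * \<delta>" w0] \<delta>_in_subfield[OF K] c_nonzero by auto
  then show "F1 \<subseteq> K" by (rule F1_minimal[OF K])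
qed

subsection \<open>The 4-torsion\<close>

text \<open>Up to sign, these are the only square roots that occur when halving the points of order 2.\<close>

lemma halving_roots_order_2:
  assumes "e \<in> {e1, e2, e3}" "roots e r1 r2 r3"
  obtains (e1) \<epsilon> \<eta> where "e = e1" "r1 = 0" "r2 = \<epsilon> * (6 * (c * q0) * s0)" "r3 = \<eta> * (6 * (c * q0) * \<sigma>0)"
      "\<epsilon> \<in> {1, -1}" "\<eta> \<in> {1, -1}"
    | (e2) \<epsilon> \<eta> where "e = e2" "r1 = \<epsilon> * (6 * \<i> * (c * q0) * s0)" "r2 = 0" "r3 = \<eta> * (6 * (c * q0) * w0)"
      "\<epsilon> \<in> {1, -1}" "\<eta> \<in> {1, -1}"
    | (e3) \<epsilon> \<eta> where "e = e3" "r1 = \<epsilon> * (6 * \<i> * (c * q0) * \<sigma>0)" "r2 = \<eta> * (6 * \<i> * (c * q0) * w0)" "r3 = 0"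
      "\<epsilon> \<in> {1, -1}" "\<eta> \<in> {1, -1}"
proof -
  have sign: "\<exists>\<epsilon>\<in>{1, -1}. r = \<epsilon> * u" if "r\<^sup>2 = u\<^sup>2" for r u :: complex
    using that by (auto simp: power2_eq_iff)
  note r = assms(2)[unfolded roots_def]
  consider "e = e1" | "e = e2" | "e = e3" using assms(1) by blast
  then show ?thesis
  proof cases
    case 1
    then have "r1 = 0" using r by simp
    moreover have "r2\<^sup>2 = (6 * (c * q0) * s0)\<^sup>2" "r3\<^sup>2 = (6 * (c * q0) * \<sigma>0)\<^sup>2"
      using r 1 e_diffs by metis+
    ultimately show ?thesis using sign e1 1 by metis
  next
    case 2
    then have "r2 = 0" using r by simp
    moreover have "r1\<^sup>2 = (6 * \<i> * (c * q0) * s0)\<^sup>2" "r3\<^sup>2 = (6 * (c * q0) * w0)\<^sup>2"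
      using r 2 e_diffs by metis+
    ultimately show ?thesis using sign e2 2 by metis
  next
    case 3
    then have "r3 = 0" using r by simp
    moreover have "r1\<^sup>2 = (6 * \<i> * (c * q0) * \<sigma>0)\<^sup>2" "r2\<^sup>2 = (6 * \<i> * (c * q0) * w0)\<^sup>2"
      using r 3 e_diffs by metis+
    ultimately show ?thesis using sign e3 3 by metis
  qed
qed

lemma four_torsion_in_subfield:
  assumes K: "complex_subfield K" "w0 \<in> K" "\<i> \<in> K" "s0 \<in> K" "c * q0 \<in> K"
    and P: "on_curve (Pt x y)" "ell_mult A 4 (Pt x y) = Pt_infinity"
  shows "x \<in> K \<and> y \<in> K"
proof -
  interpret K: complex_subfield K by fact
  have \<sigma>: "\<sigma>0 \<in> K" using K by (simp add: \<sigma>0_def)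
  consider "ell_mult A 2 (Pt x y) = Pt_infinity"
    | e r1 r2 r3 where "e \<in> {e1, e2, e3}" "roots e r1 r2 r3" "Pt x y = half r1 r2 r3"
    using mult_4_eq_infinity_iff[OF P(1)] P(2) by blast
  then show ?thesis
  proof cases
    case 1
    then show ?thesis using mult_2_eq_infinity_iff[OF P(1)] e_in_subfield[OF K(1,2)] by auto
  next
    case 2
    from 2(1,2) have "r1 \<in> K \<and> r2 \<in> K \<and> r3 \<in> K"
      by (cases rule: halving_roots_order_2) (use K \<sigma> in \<open>auto simp del: mult_minus_left\<close>)
    then show ?thesis using half_in_subfield[OF K(1)] 2(3) by auto
  qed
qed

lemma four_torsion_points:
  shows "roots e1 0 (6 * (c * q0) * s0) (6 * (c * q0) * \<sigma>0)"
    and "roots e2 (6 * \<i> * (c * q0) * s0) 0 (6 * (c * q0) * w0)"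
    and "roots e3 (6 * \<i> * (c * q0) * \<sigma>0) (6 * \<i> * (c * q0) * w0) 0"
    and "roots e3 (6 * \<i> * (c * q0) * \<sigma>0) (- (6 * \<i> * (c * q0) * w0)) 0"
  unfolding roots_def power2_minus e_diffs by simp_all

text \<open>
  Abscissas of halves of \<open>(e3, 0)\<close> and \<open>(e2, 0)\<close> give \<open>\<sigma>0\<close> and \<open>\<i> s0\<close>; an ordinate is needed
  only for \<open>c q0\<close>.
\<close>

lemma four_torsion_generates:
  assumes K: "complex_subfield K"
    and pts: "\<And>r1 r2 r3 e. \<lbrakk>e \<in> {e1, e2, e3}; roots e r1 r2 r3\<rbrakk> \<Longrightarrow> half_x r1 r2 r3 \<in> K \<and> half_y r1 r2 r3 \<in> K"
    and "e2 \<in> K"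
  shows "w0 \<in> K" "\<i> \<in> K" "s0 \<in> K" "c * q0 \<in> K"
proof -
  interpret K: complex_subfield K by fact
  note \<delta> = \<delta>_in_subfield[OF K]
  have "36 * \<delta> * w0 \<in> K"
    using K.add_closed[of e2 "24 * \<delta>"] \<open>e2 \<in> K\<close> \<delta> by (simp add: e2_def)
  then show w: "w0 \<in> K"
    using K.mult_left_cancel_closed[of "36 * \<delta>" w0] \<delta> c_nonzero by auto
  note e = e_in_subfield[OF K w]
  note r = four_torsion_points
  have "half_x (6 * \<i> * (c * q0) * \<sigma>0) (6 * \<i> * (c * q0) * w0) 0 - e3 = (- 72 * \<delta>) * \<sigma>0"
    by (subst half_x_diffs[OF r(3)]) (simp add: algebra_simps rels c_rels)
  moreover have "half_x (6 * \<i> * (c * q0) * \<sigma>0) (6 * \<i> * (c * q0) * w0) 0 - e3 \<in> K"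
    using pts[OF _ r(3)] e by blast
  ultimately have \<sigma>: "\<sigma>0 \<in> K"
    using K.mult_left_cancel_closed[of "- 72 * \<delta>" \<sigma>0] \<delta> c_nonzero by auto
  show s: "s0 \<in> K"
    by (rule K.mult_right_cancel_closed[of _ \<sigma>0]) (use \<sigma> \<sigma>0_mult_s0 nonzero in simp_all)
  have "half_x (6 * \<i> * (c * q0) * s0) 0 (6 * (c * q0) * w0) - e2 = (72 * \<delta> * s0) * \<i>"
    by (subst half_x_diffs[OF r(2)]) (simp add: algebra_simps rels c_rels)
  moreover have "half_x (6 * \<i> * (c * q0) * s0) 0 (6 * (c * q0) * w0) - e2 \<in> K"
    using pts[OF _ r(2)] e by blast
  ultimately show i: "\<i> \<in> K"
    using K.mult_left_cancel_closed[of "72 * \<delta> * s0" \<i>] \<delta> c_nonzero s nonzero by auto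
  have "half_y 0 (6 * (c * q0) * s0) (6 * (c * q0) * \<sigma>0) = (216 * \<delta> * w0 * s0 * (w0 + 2)) * (c * q0)"
    by (simp add: half_y_def \<sigma>0_def algebra_simps rels c_rels)
  moreover have "half_y 0 (6 * (c * q0) * s0) (6 * (c * q0) * \<sigma>0) \<in> K"
    using pts[OF _ r(1)] by blast
  ultimately show "c * q0 \<in> K"
    using K.mult_left_cancel_closed[of "216 * \<delta> * w0 * s0 * (w0 + 2)" "c * q0"]
      \<delta> w s c_nonzero nonzero by auto
qed

lemma has_rat_degree_4: "has_rat_degree (quad_ext F3 (c * q0)) 16"
  and complex_subfield_4: "complex_subfield (quad_ext F3 (c * q0))"
proof -
  have sq: "(c * q0)\<^sup>2 = of_rat (of_int d) * w0"
    by (simp add: power_mult_distrib c_sq q0_sq \<delta>_def)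
  then have "c * q0 \<notin> F3" using rat_w0_not_square_F3[of "of_int d" "c * q0"] d_nonzero by auto
  then show "has_rat_degree (quad_ext F3 (c * q0)) 16"
    using has_rat_degree_quad_ext[OF F3.complex_subfield_axioms has_rat_degree_F3, of "c * q0"] sq
    by simp
  show "complex_subfield (quad_ext F3 (c * q0))"
    using F3.complex_subfield_quad_ext[of "c * q0"] sq by simp
qed

theorem Ed_division_field_4: "Ed_division_field d 4 = quad_ext F3 (c * q0)"
proof (rule Ed_division_field_eqI[OF complex_subfield_4 has_rat_degree_4])
  fix x y assume P: "on_curve (Pt x y)" "ell_mult A 4 (Pt x y) = Pt_infinity"
  have "w0 \<in> quad_ext F3 (c * q0)" "\<i> \<in> quad_ext F3 (c * q0)" "s0 \<in> quad_ext F3 (c * q0)"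
    using F3.subset_quad_ext[of "c * q0"] w0_i_s0_in_F3 by (simp_all add: subset_iff)
  then show "x \<in> quad_ext F3 (c * q0) \<and> y \<in> quad_ext F3 (c * q0)"
    by (rule four_torsion_in_subfield[OF complex_subfield_4 _ _ _ F3.generator_in_quad_ext P])
next
  fix K assume K: "complex_subfield K"
    and pts: "\<And>x y. \<lbrakk>on_curve (Pt x y); ell_mult A 4 (Pt x y) = Pt_infinity\<rbrakk> \<Longrightarrow> x \<in> K \<and> y \<in> K"
  have e2: "e2 \<in> K"
    using pts[OF torsion_points(1)] torsion_points(1,2) mult_4_eq_infinity_iff by simp
  have pts4: "half_x r1 r2 r3 \<in> K \<and> half_y r1 r2 r3 \<in> K"
    if "e \<in> {e1, e2, e3}" "roots e r1 r2 r3" for r1 r2 r3 e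
    using pts[OF on_curve_half[OF that(2)] torsion_points(3)[OF that]] .
  note four_torsion_generates[OF K pts4 e2]
  then show "quad_ext F3 (c * q0) \<subseteq> K"
    by (intro F3.quad_ext_subset[OF K] F3_minimal[OF K])
qed

subsection \<open>The 8-torsion\<close>

text \<open>
  The square roots below come from \<open>s\<^sup>2 + 1 = w\<close>, \<open>s\<^sup>2 - 1 = - w s\<^sup>2\<close>, \<open>1 - w s = ((1 - s) / q)\<^sup>2\<close>,
  \<open>\<i> w s (w - \<i> s) = (1 + \<i> s)\<^sup>2\<close> and \<open>\<i> = ((1 + \<i>) / w)\<^sup>2\<close>, together with the images of the third
  and the fourth identity under \<open>s \<mapsto> - s\<close>. The two signs matter only through their product.
\<close>

lemma halving_roots_order_4_in_subfield:
  assumes K: "complex_subfield K" "\<i> \<in> K" "q0 \<in> K" "t0 \<in> K" "c \<in> K"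
    and e: "e \<in> {e1, e2, e3}" and u: "roots e u1 u2 u3"
    and r: "roots (half_x u1 u2 u3) r1 r2 r3"
  shows "r1 \<in> K \<and> r2 \<in> K \<and> r3 \<in> K"
proof -
  interpret K: complex_subfield K by fact
  have w: "w0 \<in> K" using K.mult_closed[OF K(3,3)] by (simp add: rels)
  have s: "s0 \<in> K" using K.mult_closed[OF K(4,4)] by (simp add: rels)
  have \<sigma>: "\<sigma>0 \<in> K" using w s by (simp add: \<sigma>0_def)
  note K = K w s \<sigma>
  have r1: "r1\<^sup>2 = (u1 + u2) * (u1 + u3)" and r2: "r2\<^sup>2 = (u1 + u2) * (u2 + u3)"
    and r3: "r3\<^sup>2 = (u1 + u3) * (u2 + u3)"
    using r half_x_diffs[OF u] by (simp_all add: roots_def)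
  note rs = r1 r2 r3
  note calc = power2_eq_square algebra_simps rels c_rels \<sigma>0_def
  from e u show ?thesis
  proof (cases rule: halving_roots_order_2)
    case (e1 \<epsilon> \<eta>)
    show ?thesis
    proof (cases "\<epsilon> = \<eta>")
      case True
      have "r1\<^sup>2 = (6 * c * q0)\<^sup>2" "r2\<^sup>2 = (6 * c * w0)\<^sup>2" "r3\<^sup>2 = (6 * c * w0 * \<sigma>0)\<^sup>2"
        unfolding rs e1(2-4) using e1(5,6) True by (auto simp: calc)
      from this[THEN K.square_root_closed] show ?thesis using K by simp
    next
      case False
      have "r1\<^sup>2 = (6 * \<i> * c * q0)\<^sup>2" "r2\<^sup>2 = (6 * \<i> * c * w0 * s0)\<^sup>2" "r3\<^sup>2 = (6 * c * w0)\<^sup>2"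
        unfolding rs e1(2-4) using e1(5,6) False by (auto simp: calc)
      from this[THEN K.square_root_closed] show ?thesis using K by simp
    qed
  next
    case (e2 \<epsilon> \<eta>)
    show ?thesis
    proof (cases "\<epsilon> = \<eta>")
      case True
      have "r1\<^sup>2 = (6 * \<i> * c * (1 - \<i> * s0))\<^sup>2" "r2\<^sup>2 = (6 * c * (1 + \<i>) * t0)\<^sup>2"
        "r3\<^sup>2 = (3 * c * q0 * w0 * (1 + \<i>) * \<sigma>0 * t0 * (1 - \<i> * s0))\<^sup>2"
        unfolding rs e2(2-4) using e2(5,6) True by (auto simp: calc)
      from this[THEN K.square_root_closed] show ?thesis using K by simp
    next
      case False
      have "r1\<^sup>2 = (6 * \<i> * c * (1 + \<i> * s0))\<^sup>2" "r2\<^sup>2 = (6 * \<i> * c * (1 + \<i>) * t0)\<^sup>2"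
        "r3\<^sup>2 = (3 * c * q0 * w0 * (1 - \<i>) * \<sigma>0 * t0 * (1 + \<i> * s0))\<^sup>2"
        unfolding rs e2(2-4) using e2(5,6) False by (auto simp: calc)
      from this[THEN K.square_root_closed] show ?thesis using K by simp
    qed
  next
    case (e3 \<epsilon> \<eta>)
    show ?thesis
    proof (cases "\<epsilon> = \<eta>")
      case True
      have "r1\<^sup>2 = (6 * \<i> * c * (\<sigma>0 + 1))\<^sup>2" "r2\<^sup>2 = (6 * \<i> * c * q0 * \<sigma>0 * t0 * (1 + s0))\<^sup>2"
        "r3\<^sup>2 = (6 * \<i> * c * w0 * \<sigma>0 * t0)\<^sup>2"
        unfolding rs e3(2-4) using e3(5,6) True by (auto simp: calc)
      from this[THEN K.square_root_closed] show ?thesis using K by simp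
    next
      case False
      have "r1\<^sup>2 = (6 * \<i> * c * (\<sigma>0 - 1))\<^sup>2" "r2\<^sup>2 = (6 * c * q0 * \<sigma>0 * t0 * (1 - s0))\<^sup>2"
        "r3\<^sup>2 = (6 * c * w0 * \<sigma>0 * t0)\<^sup>2"
        unfolding rs e3(2-4) using e3(5,6) False by (auto simp: calc)
      from this[THEN K.square_root_closed] show ?thesis using K by simp
    qed
  qed
qed

lemma complex_subfield_8: "complex_subfield (quad_ext F5 c)"
  using F5.complex_subfield_quad_ext[of c] \<delta>_in_subfield[OF F5.complex_subfield_axioms]
  by (simp add: c_sq)

lemma has_rat_degree_8: "has_rat_degree (quad_ext F5 c) (if c \<in> F5 then 32 else 64)"
proof (cases "c \<in> F5")
  case True
  then show ?thesis using F5.quad_ext_trivial has_rat_degree_F5 by simp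
next
  case False
  then show ?thesis
    using has_rat_degree_quad_ext[OF F5.complex_subfield_axioms has_rat_degree_F5, of c]
      \<delta>_in_subfield[OF F5.complex_subfield_axioms] by (simp add: c_sq)
qed

theorem Ed_division_field_8: "Ed_division_field d 8 = quad_ext F5 c"
proof (rule Ed_division_field_eqI[OF complex_subfield_8 has_rat_degree_8])
  fix x y assume P: "on_curve (Pt x y)" "ell_mult A 8 (Pt x y) = Pt_infinity"
  note L = complex_subfield_8
  interpret L: complex_subfield "quad_ext F5 c" by (rule L)
  have gens: "w0 \<in> quad_ext F5 c" "\<i> \<in> quad_ext F5 c" "s0 \<in> quad_ext F5 c" "q0 \<in> quad_ext F5 c"
    "t0 \<in> quad_ext F5 c" "c \<in> quad_ext F5 c"
    using F5.subset_quad_ext[of c] F5.generator_in_quad_ext[of c] generators_in_F5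
    by (simp_all add: subset_iff)
  consider "ell_mult A 4 (Pt x y) = Pt_infinity"
    | e u1 u2 u3 r1 r2 r3 where "e \<in> {e1, e2, e3}" "roots e u1 u2 u3"
        "roots (half_x u1 u2 u3) r1 r2 r3" "Pt x y = half r1 r2 r3"
    using mult_8_eq_infinity_iff[OF P(1)] P(2) by blast
  then show "x \<in> quad_ext F5 c \<and> y \<in> quad_ext F5 c"
  proof cases
    case 1
    then show ?thesis using gens by (intro four_torsion_in_subfield[OF L _ _ _ _ P(1)]) auto
  next
    case 2
    then show ?thesis
      using halving_roots_order_4_in_subfield[OF L _ _ _ _ 2(1-3)] half_in_subfield[OF L] gens by auto
  qed
next
  fix K assume K: "complex_subfield K"
    and pts: "\<And>x y. \<lbrakk>on_curve (Pt x y); ell_mult A 8 (Pt x y) = Pt_infinity\<rbrakk> \<Longrightarrow> x \<in> K \<and> y \<in> K"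
  interpret K: complex_subfield K by fact
  note \<delta> = \<delta>_in_subfield[OF K]
  note calc = power2_eq_square algebra_simps rels c_rels \<sigma>0_def
  have e2: "e2 \<in> K"
    using pts[OF torsion_points(1)] torsion_points(1,2) mult_4_eq_infinity_iff mult_8_eq_infinity_iff
    by simp
  have pts4: "half_x r1 r2 r3 \<in> K \<and> half_y r1 r2 r3 \<in> K"
    if "e \<in> {e1, e2, e3}" "roots e r1 r2 r3" for r1 r2 r3 e
    using pts[OF on_curve_half[OF that(2)]] torsion_points(3)[OF that]
      mult_8_eq_infinity_iff[OF on_curve_half[OF that(2)]] by simp
  have w: "w0 \<in> K" and i: "\<i> \<in> K" and s: "s0 \<in> K"
    by (rule four_torsion_generates[OF K pts4 e2]; assumption)+
  have \<sigma>: "\<sigma>0 \<in> K" using w s by (simp add: \<sigma>0_def)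
  note e = e_in_subfield[OF K w]
  have pts8: "half_x r1 r2 r3 \<in> K \<and> half_y r1 r2 r3 \<in> K"
    if "e \<in> {e1, e2, e3}" "roots e u1 u2 u3" "roots (half_x u1 u2 u3) r1 r2 r3"
      "r1 * r2 * r3 = half_y u1 u2 u3" for e u1 u2 u3 r1 r2 r3
    using pts[OF on_curve_half[OF that(3)] torsion_points(4)[OF that]] .
  \<comment> \<open>A half of the point of order 4 with abscissa \<open>e1 + 36 d w\<close> gives \<open>q0\<close> and then \<open>c\<close>.\<close>
  let ?u = "6 * (c * q0) * s0" and ?v = "6 * (c * q0) * \<sigma>0"
  let ?r1 = "6 * c * q0" and ?r2 = "6 * c * w0" and ?r3 = "6 * c * w0 * \<sigma>0"
  note u = four_torsion_points(1)
  have r: "roots (half_x 0 ?u ?v) ?r1 ?r2 ?r3"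
    unfolding roots_def half_x_diffs[OF u] by (simp add: calc)
  have "?r1 * ?r2 * ?r3 = half_y 0 ?u ?v" unfolding half_y_def by (simp add: calc)
  then have P: "half_x ?r1 ?r2 ?r3 \<in> K" "half_y ?r1 ?r2 ?r3 \<in> K" using pts8[OF _ u r] by auto
  have "half_x ?r1 ?r2 ?r3 - e1 = 36 * \<delta> * (w0 + 2 * \<sigma>0) + (36 * \<delta> * (w0 * (1 + \<sigma>0))) * q0"
    by (subst half_x_diffs[OF r]) (simp add: calc)
  then have "36 * \<delta> * (w0 + 2 * \<sigma>0) + (36 * \<delta> * (w0 * (1 + \<sigma>0))) * q0 \<in> K"
    using P(1) e by (metis K.diff_closed)
  then have "(36 * \<delta> * (w0 * (1 + \<sigma>0))) * q0 \<in> K"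
    by (rule K.add_left_cancel_closed) (use \<delta> w \<sigma> in auto)
  then have q: "q0 \<in> K"
    by (rule K.mult_left_cancel_closed) (use \<delta> w \<sigma> nonzero c_nonzero in auto)
  have "half_y ?r1 ?r2 ?r3 = (216 * \<delta> * ((q0 + w0) * (q0 + w0 * \<sigma>0) * (w0 + w0 * \<sigma>0))) * c"
    unfolding half_y_def by (simp add: calc)
  then have "(216 * \<delta> * ((q0 + w0) * (q0 + w0 * \<sigma>0) * (w0 + w0 * \<sigma>0))) * c \<in> K"
    "216 * \<delta> * ((q0 + w0) * (q0 + w0 * \<sigma>0) * (w0 + w0 * \<sigma>0)) \<noteq> 0"
    using P(2) half_y_nonzero[OF r] by auto
  then have c: "c \<in> K"
    by (elim K.mult_left_cancel_closed) (use \<delta> w \<sigma> q in auto)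
  \<comment> \<open>A half of the point of order 4 with abscissa \<open>e3 + 72 d / s\<close> gives \<open>t0\<close>.\<close>
  let ?u = "6 * \<i> * (c * q0) * \<sigma>0" and ?v = "- (6 * \<i> * (c * q0) * w0)"
  let ?r1 = "6 * \<i> * c * (\<sigma>0 - 1)" and ?r2 = "6 * c * q0 * \<sigma>0 * t0 * (1 - s0)"
    and ?r3 = "6 * c * w0 * \<sigma>0 * t0"
  note u = four_torsion_points(4)
  have r: "roots (half_x ?u ?v 0) ?r1 ?r2 ?r3"
    unfolding roots_def half_x_diffs[OF u] by (simp add: calc)
  have "?r1 * ?r2 * ?r3 = half_y ?u ?v 0" unfolding half_y_def by (simp add: calc)
  then have P: "half_x ?r1 ?r2 ?r3 \<in> K" using pts8[OF _ u r] by auto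
  have prods: "?r1 * ?r1 = - 36 * \<delta> * (\<sigma>0 - 1)\<^sup>2" "?r2 * ?r3 = 36 * \<delta> * q0 * w0 * \<sigma>0 * (1 - s0)"
    "?r1 * (?r2 + ?r3) = (36 * \<delta> * \<i> * ((\<sigma>0 - 1) * \<sigma>0 * (q0 * (1 - s0) + w0))) * t0"
    by (simp_all add: calc)
  have "half_x ?r1 ?r2 ?r3 - e1 = ?r1 * ?r1 + ?r2 * ?r3 + ?r1 * (?r2 + ?r3)"
    by (subst half_x_diffs[OF r]) (simp only: distrib_left distrib_right add_ac mult_ac)
  then have "half_x ?r1 ?r2 ?r3 - e1 = 36 * \<delta> * (q0 * w0 * \<sigma>0 * (1 - s0) - (\<sigma>0 - 1)\<^sup>2)
      + (36 * \<delta> * \<i> * ((\<sigma>0 - 1) * \<sigma>0 * (q0 * (1 - s0) + w0))) * t0"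
    unfolding prods by (simp add: algebra_simps)
  then have "36 * \<delta> * (q0 * w0 * \<sigma>0 * (1 - s0) - (\<sigma>0 - 1)\<^sup>2)
      + (36 * \<delta> * \<i> * ((\<sigma>0 - 1) * \<sigma>0 * (q0 * (1 - s0) + w0))) * t0 \<in> K"
    using P e by (metis K.diff_closed)
  then have "(36 * \<delta> * \<i> * ((\<sigma>0 - 1) * \<sigma>0 * (q0 * (1 - s0) + w0))) * t0 \<in> K"
    by (rule K.add_left_cancel_closed) (use \<delta> w \<sigma> q s i in auto)
  then have "t0 \<in> K"
    by (rule K.mult_left_cancel_closed) (use \<delta> w \<sigma> q s i nonzero c_nonzero in auto)
  with K i q have "F5 \<subseteq> K" by (intro F5_minimal)
  then show "quad_ext F5 c \<subseteq> K" using c by (rule F5.quad_ext_subset[OF K])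
qed

lemma c_in_F5_iff:
  assumes "squarefree d"
  shows "c \<in> F5 \<longleftrightarrow> d \<in> {1, -1, 2, -2}"
proof
  assume "c \<in> F5"
  then show "d \<in> {1, -1, 2, -2}"
    using squarefree_square_in_F5[OF d_nonzero assms, of c] by (simp add: c_sq \<delta>_def)
next
  have root: "c \<in> F5" if "z\<^sup>2 = of_int d" "z \<in> F5" for z
    using F5.square_root_closed[of c z] that by (simp add: c_sq \<delta>_def)
  have "(\<i> * w0)\<^sup>2 = - 2" by (simp add: power_mult_distrib w0_sq)
  moreover assume "d \<in> {1, -1, 2, -2}"
  ultimately show "c \<in> F5"
    using root[of 1] root[of \<i>] root[of w0] root[of "\<i> * w0"] by (auto simp: w0_sq)
qed

end

section \<open>Factoring \<open>f8\<close> along the tower\<close>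

text \<open>
  Over \<open>\<rat>(w)\<close>, \<open>\<rat>(w, i)\<close>, \<open>\<rat>(w, i, s)\<close>, \<open>\<rat>(w, i, s, q)\<close> and \<open>\<rat>(w, i, s, q, t)\<close> the polynomial \<open>f8\<close> has
  the factors \<open>A - w B\<close>, \<open>C + i D\<close>, \<open>E + s F / 2\<close>, \<open>G / 2 + q H / 4\<close> and \<open>z - (U + t V) / 4\<close>, each of which
  divides the one before it. The variables \<open>w, i, s, q\<close> stand for any elements that satisfy
  \<open>w^2 = 2\<close>, \<open>i^2 = -1\<close>, \<open>s^2 = w - 1\<close> and \<open>q^2 = w\<close>. The identities below write the difference of
  the two sides as a combination of these relations.
\<close>

definition hA :: "complex \<Rightarrow> complex" where
  "hA z = z^16 + 8*z^15 + 32*z^14 + 80*z^13 + 136*z^12 + 176*z^11 + 204*z^10 + 232*z^9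
    + 268*z^8 + 272*z^7 + 184*z^6 + 88*z^5 + 84*z^4 + 80*z^3 + 28*z^2 + 1"

definition hB :: "complex \<Rightarrow> complex" where
  "hB z = 4*z^14 + 28*z^13 + 88*z^12 + 164*z^11 + 200*z^10 + 172*z^9 + 144*z^8 + 152*z^7
    + 136*z^6 + 92*z^5 + 68*z^4 + 44*z^3 + 16*z^2 + 4*z"

definition hC :: "complex \<Rightarrow> complex \<Rightarrow> complex" where
  "hC w z = z^8 + 4*z^7 - 2*z^6*w + 8*z^6 - 6*z^5*w + 8*z^5 - 4*z^4*w - 2*z^3*w - 4*z^2*w
    + 6*z^2 - 2*z*w + 4*z"

definition hD :: "complex \<Rightarrow> complex \<Rightarrow> complex" where
  "hD w z = 2*z^5*w - 4*z^5 + 2*z^4*w - 6*z^4 - 2*z^3*w + 2*z^2 + 2*z*w - 1"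

definition hE :: "complex \<Rightarrow> complex \<Rightarrow> complex \<Rightarrow> complex" where
  "hE w i z = z^4 + 2*z^3 + z^2*w - z*w*i + z*w - 2*z - 1"

definition hF :: "complex \<Rightarrow> complex \<Rightarrow> complex \<Rightarrow> complex" where
  "hF w i z = 4*z^3 - 2*z^2*i + 6*z^2 - w*i - w - 2"

definition hG :: "complex \<Rightarrow> complex \<Rightarrow> complex \<Rightarrow> complex \<Rightarrow> complex" where
  "hG w i s z = 2*z^2 + 2*z*s + 2*z - w*i - i*s + s"

definition hH :: "complex \<Rightarrow> complex \<Rightarrow> complex \<Rightarrow> complex \<Rightarrow> complex" where
  "hH w i s z = 2*z*w*i - 2*z*w + w*i*s + w*i - w*s - w - 2*i - 2*s"

definition hU :: "complex \<Rightarrow> complex \<Rightarrow> complex \<Rightarrow> complex \<Rightarrow> complex" where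
  "hU w i s q = w*q - w*i*q - 2*s - 2"

definition hV :: "complex \<Rightarrow> complex \<Rightarrow> complex \<Rightarrow> complex \<Rightarrow> complex" where
  "hV w i s q = i*s*q - w*i*s - w*i*q - w*s*q - w*s - i*q - s*q - 2*s - q"

lemma f8_eq: "f8 z = (hA z)\<^sup>2 - 2 * (hB z)\<^sup>2"
  unfolding f8_def hA_def hB_def by Groebner_Basis.algebra

lemma hA_hB_eq:
  assumes "w\<^sup>2 = 2"
  shows "hA z - w * hB z = (hC w z)\<^sup>2 + (hD w z)\<^sup>2"
proof -
  have "(hA z - w * hB z - ((hC w z)^2 + (hD w z)^2)) =
      (w^2 - 2) * (-4*z^12 - 24*z^11 - 56*z^10 - 64*z^9 - 52*z^8 - 64*z^7 - 72*z^6 - 40*z^5 - 16*z^4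
          - 16*z^3 - 8*z^2)"
    unfolding hA_def hB_def hC_def hD_def by Groebner_Basis.algebra
  then show ?thesis using assms by simp
qed

lemma hC_hD_eq:
  assumes "w\<^sup>2 = 2" "i\<^sup>2 = - 1"
  shows "4 * (hC w z + i * hD w z) = (2 * hE w i z)\<^sup>2 - (w - 1) * (hF w i z)\<^sup>2"
proof -
  have "(4 * (hC w z + i * hD w z) - ((2 * hE w i z)^2 - (w - 1) * (hF w i z)^2)) =
      (i^2 + 1) * (4*z^4*w - 4*z^4 - 4*z^2*w + w^3 - w^2)
      + (w^2 - 2) * (2*w*i - 4*z^4 - 16*z^3 - 16*z^2 + 2*i + 4)"
    unfolding hC_def hD_def hE_def hF_def by Groebner_Basis.algebra
  then show ?thesis using assms by simp
qed

lemma hE_hF_eq: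
  assumes "w\<^sup>2 = 2" "i\<^sup>2 = - 1" "s\<^sup>2 = w - 1"
  shows "8 * (2 * hE w i z + s * hF w i z) = (2 * hG w i s z)\<^sup>2 - w * (hH w i s z)\<^sup>2"
proof -
  have "(8 * (2 * hE w i z + s * hF w i z) - ((2 * hG w i s z)^2 - w * (hH w i s z)^2)) =
      (s^2 - (w - 1)) * (16*z*i - 16*z^2 - 16*z + w^3*i^2 - 2*w^3*i + w^3 - 4*w^2*i + 4*w^2 + 4*w - 4*i^2
          + 8*i - 4)
      + (i^2 + 1) * (4*z^2*w^3 + 4*z*w^3*s + 4*z*w^3 - 8*z*w^2 + w^4 + 2*w^3*s - 4*w^2*s - 8*w^2 - 8*w*s
          + 4)
      + (w^2 - 2) * (8*z*i - 8*z^2*w*i - 8*z*w*i*s - 8*z*w*i - 8*z*i*s + 8*z*s + 8*z - 2*w^2*i - 4*w*i*s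
          - 4*w*i + 4*w + 4*i + 8*s + 8)"
    unfolding hE_def hF_def hG_def hH_def by Groebner_Basis.algebra
  then show ?thesis using assms by simp
qed

lemma hG_hH_eq:
  assumes "w\<^sup>2 = 2" "i\<^sup>2 = - 1" "s\<^sup>2 = w - 1" "q\<^sup>2 = w"
  shows "4 * (2 * hG w i s z + q * hH w i s z) = (4 * z - hU w i s q)\<^sup>2 - s * (hV w i s q)\<^sup>2"
proof -
  have "(4 * (2 * hG w i s z + q * hH w i s z) - ((4 * z - hU w i s q)^2 - s * (hV w i s q)^2)) =
      (q^2 - w) * (w^2*i^2*s - w^2*i^2 + 2*w^2*i*s^2 + 2*w^2*i + w^2*s^3 - w^2 - 2*w*i^2*s^2
          + 2*w*i^2*s - 2*w*i*s^3 + 4*w*i*s^2 + 2*w*i*s + 2*w*s^3 + 2*w*s^2 + i^2*s^3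
          - 2*i^2*s^2 + i^2*s - 2*i*s^3 + 2*i*s + s^3 + 2*s^2 + s)
      + (s^2 - (w - 1)) * (2*w^3*i + w^3*s + w^2*i^2*s + 2*w^2*i^2*q - 2*w^2*i^2 + 2*w^2*i*s*q + 2*w^2*i*q
          + 4*w^2*i + 2*w^2*s*q + 3*w^2*s + 2*w^2 - 2*w*i^2*s*q + w*i^2*s + 2*w*i^2*q
          - 2*w*i^2 + 2*w*i*s + 8*w*i*q + 6*w*s*q + 5*w*s + 2*w*q + 2*w - 4*i*s*q + 4*i*q
          + 4*s*q + 4*s + 4*q - 4)
      + (i^2 + 1) * (2*w^3*s + 2*w^3*q - 3*w^3 - 2*w^2*s*q + 2*w^2*s + 2*w*s*q - 2*w*q + 2*w)
      + (w^2 - 2) * (2*w^2*i + w^2*s + 2*w*i*s*q + 2*w*i*q + 4*w*i + 2*w*s*q - 2*w*q + 4*w - 2*i*s*q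
          + 4*i*s + 6*i*q + 6*s*q + 2*s + 2*q)"
    unfolding hG_def hH_def hU_def hV_def by Groebner_Basis.algebra
  then show ?thesis using assms by simp
qed

text \<open>
  At each level the two polynomials are coprime; the first lines of the proofs are Bezout
  relations. At the first level \<open>hB\<close> splits off small factors, and only the remaining one, \<open>hP\<close>,
  needs such a relation.
\<close>

definition hP :: "complex \<Rightarrow> complex" where
  "hP z = z^12 + 6*z^11 + 16*z^10 + 25*z^9 + 25*z^8 + 18*z^7 + 18*z^6 + 20*z^5 + 14*z^4
    + 9*z^3 + 8*z^2 + 3*z + 1"

lemma hA_hP_coprime:
  assumes "hP z = 0" "hA z = 0"
  shows False
proof -
  have "(2229637699454339099 - 341570334991870765*z^15 - 2784261785629396217*z^14
        - 11176700824181387927*z^13 - 27902968638115783731*z^12 - 46923243221436620059*z^11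
        - 59430126033766216257*z^10 - 67691332891346430355*z^9 - 76468318370694015941*z^8
        - 88222804356004424569*z^7 - 90036920831726264891*z^6 - 56566739954236667551*z^5
        - 23880116519527613075*z^4 - 25263092802963515541*z^3 - 26040521649565571501*z^2
        - 8807758676726050537*z) * hP z
      + (341570334991870765*z^11 + 2101121115645654687*z^10 + 5608177252922595493*z^9
        + 8623700004679844762*z^8 + 8319544311056590955*z^7 + 5551629288968062141*z^6
        + 5576471636148909299*z^5 + 6719484742913875493*z^4 + 4197894196912664929*z^3
        + 3037649966353314940*z^2 + 2118845578363033240*z + 1128180218491274835) * hA z - 3357817917945613934
      = 0"
    unfolding hA_def hP_def by Groebner_Basis.algebra
  then show False using assms by simp
qed

lemma hA_hB_coprime:
  assumes "hA z = 0" "hB z = 0"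
  shows False
proof -
  have "hB z = 4 * z * (z + 1) * hP z" unfolding hB_def hP_def by Groebner_Basis.algebra
  then consider "z = 0" | "z = - 1" | "hP z = 0"
    using assms(2) by (auto simp: eq_neg_iff_add_eq_0)
  then show False
  proof cases
    case 3
    then show False using hA_hP_coprime assms(1) by blast
  qed (use assms(1) in \<open>simp_all add: hA_def\<close>)
qed

lemma hC_hD_coprime:
  assumes "w\<^sup>2 = 2" and "hC w z = 0" "hD w z = 0"
  shows False
proof -
  have "(176352*z^4 - 968448*z^4*w - 1393760*z^3*w - 1607072*z^3 - 948160*z^2*w - 2857608*z^2
        - 237408*z*w + 573040*z + 831440*w + 1200396) * hC w z
      + (1873550*z^3*w - 440136*z^7*w - 396048*z^7 - 1780896*z^6*w - 1852376*z^6
        - 2987902*z^5*w - 2550420*z^5 - 1416398*z^4*w - 272482*z^4 + 1497568*z^3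
        + 1042992*z^2*w + 2598610*z^2 - 53814*z*w + 1475824*z - 489391) * hD w z - 489391
      = (w^2 - 2) * (3351400*z^9 - 880272*z^12 - 4442064*z^11 - 6720428*z^10 + 20142508*z^8
          + 18779800*z^7 + 2470972*z^6 + 342840*z^5 + 7583944*z^4 + 3269056*z^3 - 2958572*z^2
          - 1662880*z)"
    unfolding hC_def hD_def by Groebner_Basis.algebra
  then show False using assms by simp
qed

lemma hE_hF_coprime:
  assumes "w\<^sup>2 = 2" "i\<^sup>2 = - 1" and "hE w i z = 0" "hF w i z = 0"
  shows False
proof -
  have "(26448*z^2*w*i - 12336*z^2*w + 3752*z^2*i - 13128*z^2 + 51496*z*w*i - 18008*z*w
        + 31904*z*i - 24112*z + 10136*w*i - 22224*w + 30348*i - 30900) * hE w i z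
      + (3084*z^3*w - 6612*z^3*w*i - 938*z^3*i + 3282*z^3 - 14638*z^2*w*i + 9350*z^2*w
        - 6804*z^2*i + 8138*z^2 - 2588*z*w*i + 11136*z*w - 22488*z*i + 17144*z + 2690*w*i
        + 503*w - 18367*i + 2851) * hF w i z - 29572
      = (i^2 + 1) * (13224*z^5*w + 1876*z^5 + 29276*z^4*w + 13608*z^4 - 19836*z^3*w^2 + 2362*z^3*w
          + 44976*z^3 - 36858*z^2*w^2 - 30480*z^2*w + 36734*z^2 - 7548*z*w^2 - 7860*z*w
          - 2690*w^2 + 18367*w)
      + (w^2 - 2) * (26448*z^4*i - 12336*z^4 + 93808*z^3*i - 13592*z^3 + 84928*z^2*i - 12724*z^2
          + 23812*z*i - 25812*z - 3193*i + 2187)"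
    unfolding hE_def hF_def by Groebner_Basis.algebra
  then show False using assms by simp
qed

lemma hG_hH_coprime:
  assumes "w\<^sup>2 = 2" "i\<^sup>2 = - 1" "s\<^sup>2 = w - 1" and "hG w i s z = 0" "hH w i s z = 0"
  shows False
proof -
  have "(92*w*i - 32*w*i*s - 40*w*s - 8*w - 112*i*s + 76*i + 24*s - 28) * hG w i s z
      + (12*z*w*i - 22*z*w*i*s + 34*z*w*s - 26*z*w - 36*z*i*s + 42*z*i - 4*z*s - 50*z
        - 11*w*i*s + 6*w*i + 17*w*s - 54*w - 18*i*s + 62*i - 2*s + 16) * hH w i s z - 328
      = (s^2 - (w - 1)) * (56*z*w^2*i - 22*z*w^2*i^2 - 34*z*w^2 - 36*z*w*i^2 + 12*z*w*i - 144*z*w - 152*z*i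
          + 56*z - 11*w^2*i^2 + 28*w^2*i - 17*w^2 + 14*w*i^2 + 46*w*i - 72*w + 112*i^2 - 100*i
          + 28)
      + (i^2 + 1) * (24*z^2*w^2 - 44*z^2*w^2*s - 72*z^2*w*s + 84*z^2*w - 22*z*w^3 - 32*z*w^2*s + 10*z*w^2
          + 14*z*w*s + 178*z*w + 72*z*s - 84*z - 11*w^3 + 27*w^2*s - 61*w^2 + 86*w*s + 72*w
          - 40*s - 236)
      + (w^2 - 2) * (112*z^2*i*s - 76*z^2*i - 24*z^2*s + 28*z^2 + 56*z*w*i - 12*z*w + 74*z*i*s - 202*z*i
          - 10*z*s + 14*z + 28*w*i - 6*w + 8*i*s - 34*i + 10*s + 60)"
    unfolding hG_def hH_def by Groebner_Basis.algebra
  then show False using assms by simp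
qed

text \<open>The second factor is, up to the factor 16, the inverse of \<open>V\<close>.\<close>

lemma hV_nonzero:
  assumes "w\<^sup>2 = 2" "i\<^sup>2 = - 1" "s\<^sup>2 = w - 1" "q\<^sup>2 = w"
  shows "hV w i s q \<noteq> 0"
proof -
  have "hV w i s q * (w*i*s*q - 2*w*i*s + w*i*q - w*s*q - w*q + 2*i*q - 2*i - 2*s*q + 2) - 16 =
      (q^2 - w) * (w^2*i - w^2*i^2*s - w^2*i^2 - w^2*i*s^2 + w^2*s^2 + w^2*s + w*i^2*s^2 - 3*w*i^2
          - 2*w*i*s^2 - 2*w*i*s + 3*w*s^2 + 2*w*s + w + 2*i^2*s - 2*i^2 - 2*i*s^2 - 2*i
          + 2*s^2 + 2*s)
      + (s^2 - (w - 1)) * (w^3 - w^3*i - w^2*i^2*q + 3*w^2*i^2 + 2*w^2*i*q + w^2*q + 3*w^2 - 2*w*i^2*q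
          + 2*w*i*q + 2*w*i + 4*w*q + 2*w + 4*q)
      + (i^2 + 1) * (2*w^3 - w^3*s - w^3*q + w^2*s*q - w^2*q - 6*w^2 + 4*w*s + 4*w*q - 2*w - 2*s*q + 2*q)
      + (w^2 - 2) * (w^2 - w^2*i + 2*w*i*q + 2*w*i + 2*w*s + 2*w*q - 2*i*s + 2*s + 4*q + 8)"
    unfolding hV_def by Groebner_Basis.algebra
  then show ?thesis using assms by auto
qed

section \<open>Normality of the tower and the roots of \<open>f4\<close> and \<open>f8\<close>\<close>

text \<open>
  The defining relations of the generators of \<open>F3\<close>. The generators of \<open>F5\<close> are described by
  \<open>root_system i (q\<^sup>2) (t\<^sup>2)\<close>.
\<close>

definition root_system :: "complex \<Rightarrow> complex \<Rightarrow> complex \<Rightarrow> bool" where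
  "root_system i w s \<longleftrightarrow> i\<^sup>2 = - 1 \<and> w\<^sup>2 = 2 \<and> s\<^sup>2 = w - 1"

lemma root_system_0: "root_system \<i> w0 s0"
  by (simp add: root_system_def w0_sq s0_sq)

context complex_subfield
begin

lemma imaginary_unit_closed:
  assumes "i \<in> K" "i\<^sup>2 = - 1" "x\<^sup>2 = - 1"
  shows "x \<in> K"
  using square_root_closed[of x i] assms by simp

text \<open>A primitive eighth root of unity \<open>x\<close> with \<open>x\<^sup>2 = j\<close> is \<open>(1 + j) / w\<close> up to sign.\<close>

lemma eighth_root_of_unity_closed:
  assumes "j \<in> K" "j\<^sup>2 = - 1" "w \<in> K" "w\<^sup>2 = 2" "x\<^sup>2 = j"
  shows "x \<in> K"
proof (rule square_root_closed)
  have "(1 + j)\<^sup>2 = 2 * j" using assms(2) by (simp add: power2_sum)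
  then show "x\<^sup>2 = ((1 + j) / w)\<^sup>2" using assms(4,5) by (simp add: power_divide)
  show "(1 + j) / w \<in> K" using assms by simp
qed

text \<open>
  A field that contains one solution of the defining relations contains all of them: \<open>F3\<close>, and by
  the next lemma \<open>F5\<close>, is normal over \<open>\<rat>\<close>. If \<open>w\<close> changes its sign, then \<open>s\<close> becomes \<open>\<plusminus>i / s\<close>, and
  \<open>t\<close> becomes \<open>\<zeta> / t\<close> for a primitive eighth root of unity \<open>\<zeta>\<close>.
\<close>

lemma root_system_closed:
  assumes "i \<in> K" "w \<in> K" "s \<in> K" "root_system i w s" "root_system i' w' s'"
  shows "i' \<in> K" "w' \<in> K" "s' \<in> K"
proof -
  note r = assms(4,5)[unfolded root_system_def]
  show "i' \<in> K" using imaginary_unit_closed[of i i'] assms(1) r by simp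
  show w': "w' \<in> K" using square_root_closed[of w' w] assms(2) r by simp
  have "w' = w \<or> w' = - w" using r by (simp flip: power2_eq_iff)
  then show "s' \<in> K"
  proof
    assume "w' = w"
    then show ?thesis using square_root_closed[of s' s] assms(3) r by simp
  next
    assume w: "w' = - w"
    have "(s' * s)\<^sup>2 = (- w - 1) * (w - 1)" using r w by (simp add: power_mult_distrib)
    also have "\<dots> = 1 - w\<^sup>2" by (simp add: power2_eq_square algebra_simps)
    finally have sq: "(s' * s)\<^sup>2 = - 1" using r by simp
    then have "s' * s \<in> K" using imaginary_unit_closed[of i] assms(1) r by simp
    moreover have "s \<noteq> 0" using sq by auto
    ultimately show ?thesis using mult_right_cancel_closed assms(3) by blast
  qed
qed

lemma fourth_root_system_closed:
  assumes K: "i \<in> K" "q \<in> K" "t \<in> K" and r: "root_system i (q\<^sup>2) (t\<^sup>2)" "root_system i' (q'\<^sup>2) (t'\<^sup>2)"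
  shows "i' \<in> K" "q' \<in> K" "t' \<in> K"
proof -
  have K': "i' \<in> K" "q'\<^sup>2 \<in> K" "t'\<^sup>2 \<in> K"
    using root_system_closed[OF _ _ _ r] K by auto
  show "i' \<in> K" by fact
  note r = r[unfolded root_system_def]
  have i: "x \<in> K" if "x\<^sup>2 = - 1" for x using imaginary_unit_closed[OF K(1)] r that by blast
  have \<zeta>: "x \<in> K" if "(x\<^sup>2)\<^sup>2 = - 1" for x
    using eighth_root_of_unity_closed[of "x\<^sup>2" "q\<^sup>2" x] i[of "x\<^sup>2"] that K r by simp
  have i_mult: "(i * x)\<^sup>2 = - x\<^sup>2" for x using r by (simp add: power_mult_distrib)
  have root: "x \<in> K" if "x\<^sup>2 = y\<^sup>2 \<or> x\<^sup>2 = - y\<^sup>2" "y \<in> K" for x y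
    using that square_root_closed[of x y] square_root_closed[of x "i * y"] K(1) i_mult by auto
  have "q'\<^sup>2 = q\<^sup>2 \<or> q'\<^sup>2 = - q\<^sup>2" using r by (simp flip: power2_eq_iff)
  then show "q' \<in> K" and "t' \<in> K"
  proof -
    assume *: "q'\<^sup>2 = q\<^sup>2 \<or> q'\<^sup>2 = - q\<^sup>2"
    then show "q' \<in> K" using root K(2) by blast
    from * show "t' \<in> K"
    proof
      assume "q'\<^sup>2 = q\<^sup>2"
      then have "(t'\<^sup>2)\<^sup>2 = (t\<^sup>2)\<^sup>2" using r by metis
      then have "t'\<^sup>2 = t\<^sup>2 \<or> t'\<^sup>2 = - t\<^sup>2" by (rule power2_eq_iff[THEN iffD1])
      then show ?thesis using root K(3) by blast
    next
      assume w: "q'\<^sup>2 = - q\<^sup>2"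
      have "((t' * t)\<^sup>2)\<^sup>2 = (- q\<^sup>2 - 1) * (q\<^sup>2 - 1)"
        using r w by (simp add: power_mult_distrib)
      also have "\<dots> = 1 - (q\<^sup>2)\<^sup>2" by (simp add: power2_eq_square algebra_simps)
      finally have sq: "((t' * t)\<^sup>2)\<^sup>2 = - 1" using r by simp
      then have "t' * t \<in> K" by (rule \<zeta>)
      moreover have "t \<noteq> 0" using sq by auto
      ultimately show ?thesis using mult_right_cancel_closed K(3) by blast
    qed
  qed
qed

text \<open>A root of \<open>f4\<close> is \<open>\<zeta> s\<close> for a primitive eighth root of unity \<open>\<zeta> = (1 + i) / w\<close>.\<close>

lemma f4_root:
  assumes "\<alpha> \<in> K" "f4 \<alpha> = 0"
  obtains i w s where "i \<in> K" "w \<in> K" "s \<in> K" "root_system i w s" "\<alpha> = s * (1 + i) / w"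
proof -
  define w where "w = (\<alpha> ^ 4 + 3) / 2"
  have "w\<^sup>2 = (f4 \<alpha> + 8) / 4"
    by (simp add: w_def f4_def power_divide power2_eq_square field_simps flip: power_add)
  then have w: "w\<^sup>2 = 2" using assms(2) by simp
  have \<alpha>: "\<alpha> ^ 4 = 2 * w - 3" by (simp add: w_def)
  have w1: "w \<noteq> 1" "w \<noteq> 0" using w by auto
  define i where "i = \<alpha>\<^sup>2 / (w - 1)"
  have "(w - 1)\<^sup>2 = 3 - 2 * w" using w by (simp add: power2_diff)
  moreover have "(\<alpha>\<^sup>2)\<^sup>2 = - (3 - 2 * w)" using \<alpha> by simp
  ultimately have i: "i\<^sup>2 = - 1"
    using w1 unfolding i_def power_divide by (metis divide_minus_left divide_self power_not_zero right_minus_eq)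
  have i1: "1 + i \<noteq> 0"
  proof
    assume "1 + i = 0"
    then have "i = - 1" by (simp add: eq_neg_iff_add_eq_0 add.commute)
    with i show False by simp
  qed
  define s where "s = \<alpha> * w / (1 + i)"
  have "(1 + i)\<^sup>2 = 2 * i" using i by (simp add: power2_sum)
  then have "s\<^sup>2 = \<alpha>\<^sup>2 / i" using w by (simp add: s_def power_divide power_mult_distrib)
  moreover have "\<alpha>\<^sup>2 = i * (w - 1)" using w1 by (simp add: i_def)
  moreover have "i \<noteq> 0" using i by auto
  ultimately have s: "s\<^sup>2 = w - 1" by simp
  have wK: "w \<in> K" using assms(1) by (simp add: w_def)
  then have iK: "i \<in> K" using assms(1) by (simp add: i_def)
  with wK have "s \<in> K" using assms(1) by (simp add: s_def)
  moreover have "\<alpha> = s * (1 + i) / w" using i1 w1 by (simp add: s_def)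
  ultimately show ?thesis using that iK wK i w s by (simp add: root_system_def)
qed

lemma quotient_root:
  fixes x y c :: complex
  assumes "x\<^sup>2 = c * y\<^sup>2" "x = 0 \<Longrightarrow> y = 0 \<Longrightarrow> False" "x \<in> K" "y \<in> K"
  obtains r where "r \<in> K" "r\<^sup>2 = c" "x = r * y"
proof -
  have "y \<noteq> 0" using assms(1,2) by auto
  then show ?thesis using that[of "x / y"] assms by (simp add: power_divide)
qed

lemma f8_root:
  assumes "\<beta> \<in> K" "f8 \<beta> = 0"
  obtains i q t where "i \<in> K" "q \<in> K" "t \<in> K" "root_system i (q\<^sup>2) (t\<^sup>2)"
    "\<beta> = (hU (q\<^sup>2) i (t\<^sup>2) q + t * hV (q\<^sup>2) i (t\<^sup>2) q) / 4"
proof -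
  have sq: "(hA \<beta>)\<^sup>2 = 2 * (hB \<beta>)\<^sup>2" using f8_eq[of \<beta>] assms(2) by simp
  have mem: "hA \<beta> \<in> K" "hB \<beta> \<in> K" using assms(1) by (simp_all add: hA_def hB_def)
  obtain w where wK: "w \<in> K" and w: "w\<^sup>2 = 2" and A: "hA \<beta> = w * hB \<beta>"
    using quotient_root[OF sq hA_hB_coprime mem] .
  have sq: "(hC w \<beta>)\<^sup>2 = - 1 * (hD w \<beta>)\<^sup>2"
    using hA_hB_eq[OF w, of \<beta>] A by (simp add: eq_neg_iff_add_eq_0)
  have mem: "hC w \<beta> \<in> K" "hD w \<beta> \<in> K" using assms(1) wK by (simp_all add: hC_def hD_def)
  obtain j where jK: "j \<in> K" and j: "j\<^sup>2 = - 1" and C: "hC w \<beta> = j * hD w \<beta>"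
    using quotient_root[OF sq hC_hD_coprime[OF w] mem] .
  define i where "i = - j"
  have iK: "i \<in> K" and i: "i\<^sup>2 = - 1" and C: "hC w \<beta> + i * hD w \<beta> = 0"
    using jK j C by (simp_all add: i_def)
  have sq: "(2 * hE w i \<beta>)\<^sup>2 = (w - 1) * (hF w i \<beta>)\<^sup>2"
    using hC_hD_eq[OF w i, of \<beta>] C by simp
  have mem: "2 * hE w i \<beta> \<in> K" "hF w i \<beta> \<in> K"
    using assms(1) wK iK by (simp_all add: hE_def hF_def)
  have coprime: "2 * hE w i \<beta> = 0 \<Longrightarrow> hF w i \<beta> = 0 \<Longrightarrow> False"
    using hE_hF_coprime[OF w i] by simp
  obtain s' where sK': "s' \<in> K" and s': "s'\<^sup>2 = w - 1" and E: "2 * hE w i \<beta> = s' * hF w i \<beta>"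
    using quotient_root[OF sq coprime mem] .
  define s where "s = - s'"
  have sK: "s \<in> K" and s: "s\<^sup>2 = w - 1" and E: "2 * hE w i \<beta> + s * hF w i \<beta> = 0"
    using sK' s' E by (simp_all add: s_def)
  have sq: "(2 * hG w i s \<beta>)\<^sup>2 = w * (hH w i s \<beta>)\<^sup>2"
    using hE_hF_eq[OF w i s, of \<beta>] E by simp
  have mem: "2 * hG w i s \<beta> \<in> K" "hH w i s \<beta> \<in> K"
    using assms(1) wK iK sK by (simp_all add: hG_def hH_def)
  have coprime: "2 * hG w i s \<beta> = 0 \<Longrightarrow> hH w i s \<beta> = 0 \<Longrightarrow> False"
    using hG_hH_coprime[OF w i s] by simp
  obtain q' where qK': "q' \<in> K" and q': "q'\<^sup>2 = w" and G: "2 * hG w i s \<beta> = q' * hH w i s \<beta>"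
    using quotient_root[OF sq coprime mem] .
  define q where "q = - q'"
  have qK: "q \<in> K" and q: "q\<^sup>2 = w" and G: "2 * hG w i s \<beta> + q * hH w i s \<beta> = 0"
    using qK' q' G by (simp_all add: q_def)
  have sq: "(4 * \<beta> - hU w i s q)\<^sup>2 = s * (hV w i s q)\<^sup>2"
    using hG_hH_eq[OF w i s q, of \<beta>] G by simp
  have mem: "4 * \<beta> - hU w i s q \<in> K" "hV w i s q \<in> K"
    using assms(1) wK iK sK qK by (simp_all add: hU_def hV_def)
  obtain t where tK: "t \<in> K" and t: "t\<^sup>2 = s" and U: "4 * \<beta> - hU w i s q = t * hV w i s q"
    using quotient_root[OF sq _ mem] hV_nonzero[OF w i s q] by metis
  have "\<beta> = (hU w i s q + t * hV w i s q) / 4"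
    using U by (simp add: algebra_simps)
  then show ?thesis using that[OF iK qK tK] w i s q t by (simp add: root_system_def)
qed

end

section \<open>The division fields as fields generated by roots of \<open>f4\<close> and \<open>f8\<close>\<close>

context twist
begin

lemma rat_adjoin_f4_root:
  assumes "f4 \<alpha> = 0"
  shows "rat_adjoin {\<alpha>, c * q0} = quad_ext F3 (c * q0)"
proof (rule rat_adjoin_eqI[OF complex_subfield_4])
  interpret M: complex_subfield "quad_ext F3 (c * q0)" by (rule complex_subfield_4)
  interpret UN: complex_subfield UNIV by unfold_locales auto
  obtain i w s where r: "root_system i w s" and \<alpha>: "\<alpha> = s * (1 + i) / w"
    using UN.f4_root[OF _ assms] by auto
  have "i \<in> F3" "w \<in> F3" "s \<in> F3"
    using F3.root_system_closed[OF _ _ _ root_system_0 r] by auto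
  then have "\<alpha> \<in> F3" by (simp add: \<alpha>)
  then show "{\<alpha>, c * q0} \<subseteq> quad_ext F3 (c * q0)"
    using F3.subset_quad_ext[of "c * q0"] F3.generator_in_quad_ext[of "c * q0"] by auto
next
  fix K assume K: "complex_subfield K" and sub: "{\<alpha>, c * q0} \<subseteq> K"
  interpret K: complex_subfield K by fact
  have "\<alpha> \<in> K" using sub by simp
  then obtain i w s where "i \<in> K" "w \<in> K" "s \<in> K" and r: "root_system i w s"
    by (elim K.f4_root[OF _ assms])
  then have "\<i> \<in> K" "w0 \<in> K" "s0 \<in> K"
    using K.root_system_closed[OF _ _ _ r root_system_0] by auto
  then show "quad_ext F3 (c * q0) \<subseteq> K"
    using sub by (intro F3.quad_ext_subset[OF K] F3_minimal[OF K]) auto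
qed

lemma rat_adjoin_f8_root:
  assumes "f8 \<beta> = 0"
  shows "rat_adjoin {\<beta>, c} = quad_ext F5 c"
proof (rule rat_adjoin_eqI[OF complex_subfield_8])
  interpret UN: complex_subfield UNIV by unfold_locales auto
  have r0: "root_system \<i> (q0\<^sup>2) (t0\<^sup>2)" using root_system_0 by (simp add: q0_sq t0_sq)
  obtain i q t where r: "root_system i (q\<^sup>2) (t\<^sup>2)"
    and \<beta>: "\<beta> = (hU (q\<^sup>2) i (t\<^sup>2) q + t * hV (q\<^sup>2) i (t\<^sup>2) q) / 4"
    using UN.f8_root[OF _ assms] by auto
  have "i \<in> F5" "q \<in> F5" "t \<in> F5"
    using F5.fourth_root_system_closed[OF _ _ _ r0 r] by auto
  then have "\<beta> \<in> F5" by (simp add: \<beta> hU_def hV_def)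
  then show "{\<beta>, c} \<subseteq> quad_ext F5 c"
    using F5.subset_quad_ext[of c] F5.generator_in_quad_ext[of c] by auto
next
  fix K assume K: "complex_subfield K" and sub: "{\<beta>, c} \<subseteq> K"
  interpret K: complex_subfield K by fact
  have r0: "root_system \<i> (q0\<^sup>2) (t0\<^sup>2)" using root_system_0 by (simp add: q0_sq t0_sq)
  have "\<beta> \<in> K" using sub by simp
  then obtain i q t where "i \<in> K" "q \<in> K" "t \<in> K" and r: "root_system i (q\<^sup>2) (t\<^sup>2)"
    by (elim K.f8_root[OF _ assms])
  then have "\<i> \<in> K" "q0 \<in> K" "t0 \<in> K"
    using K.fourth_root_system_closed[OF _ _ _ r r0] by auto
  then show "quad_ext F5 c \<subseteq> K"
    using sub by (intro F5.quad_ext_subset[OF K] F5_minimal[OF K]) auto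
qed

end

lemma q0_eq_root_4: "q0 = complex_of_real (root 4 2)"
proof -
  have "root 4 2 = root (2 * 2) 2" by simp
  also have "\<dots> = sqrt (sqrt 2)" by (subst real_root_mult_exp) (simp_all add: sqrt_def)
  finally show ?thesis by (simp add: q0_def)
qed

lemma rat_adjoin_sqrt_2: "rat_adjoin {complex_of_real (sqrt 2)} = F1"
  using w0_in_F1 F1_minimal
  by (intro rat_adjoin_eqI[OF F1.complex_subfield_axioms]) (auto simp: w0_def)

theorem proposition3p7:
  fixes d :: int
  assumes "d \<noteq> 0" and "squarefree d"
  shows "Ed_division_field d 2 = rat_adjoin {complex_of_real (sqrt 2)}
    \<and> (\<forall>\<alpha>. f4 \<alpha> = 0 \<longrightarrow>
          Ed_division_field d 4 = rat_adjoin {\<alpha>, csqrt (of_int d) * complex_of_real (root 4 2)})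
    \<and> (\<forall>\<beta>. f8 \<beta> = 0 \<longrightarrow>
          Ed_division_field d 8 = rat_adjoin {\<beta>, csqrt (of_int d)})
    \<and> has_rat_degree (Ed_division_field d 2) 2
    \<and> has_rat_degree (Ed_division_field d 4) 16
    \<and> (has_rat_degree (Ed_division_field d 8) 32 \<longleftrightarrow> d \<in> {1, -1, 2, -2})
    \<and> (d \<notin> {1, -1, 2, -2} \<longrightarrow> has_rat_degree (Ed_division_field d 8) 64)"
proof -
  interpret twist d by unfold_locales fact
  have deg8: "has_rat_degree (Ed_division_field d 8) (if d \<in> {1, -1, 2, -2} then 32 else 64)"
    using has_rat_degree_8 c_in_F5_iff[OF assms(2)] by (simp only: Ed_division_field_8)
  have "has_rat_degree (Ed_division_field d 8) 32 \<longleftrightarrow> d \<in> {1, -1, 2, -2}"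
  proof
    assume "has_rat_degree (Ed_division_field d 8) 32"
    then have "32 = (if d \<in> {1, -1, 2, -2} then 32 else (64 :: nat))"
      using deg8 by (rule has_rat_degree_unique)
    then show "d \<in> {1, -1, 2, -2}" by (auto split: if_splits)
  qed (use deg8 in \<open>simp split: if_splits\<close>)
  moreover have "d \<notin> {1, -1, 2, -2} \<longrightarrow> has_rat_degree (Ed_division_field d 8) 64"
    using deg8 by auto
  moreover have "Ed_division_field d 4 = rat_adjoin {\<alpha>, csqrt (of_int d) * complex_of_real (root 4 2)}"
    if "f4 \<alpha> = 0" for \<alpha>
    using rat_adjoin_f4_root[OF that] by (simp add: Ed_division_field_4 c_def q0_eq_root_4)
  moreover have "Ed_division_field d 8 = rat_adjoin {\<beta>, csqrt (of_int d)}" if "f8 \<beta> = 0" for \<beta>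
    using rat_adjoin_f8_root[OF that] by (simp add: Ed_division_field_8 c_def)
  moreover have "Ed_division_field d 2 = rat_adjoin {complex_of_real (sqrt 2)}"
    by (simp add: Ed_division_field_2 rat_adjoin_sqrt_2)
  moreover have "has_rat_degree (Ed_division_field d 2) 2"
    by (simp add: Ed_division_field_2 has_rat_degree_F1)
  moreover have "has_rat_degree (Ed_division_field d 4) 16"
    using has_rat_degree_4 by (simp add: Ed_division_field_4)
  ultimately show ?thesis by blast
qed

end
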